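(* Let $G$ be a finite group, let $\mathsf{S}$ be a supercharacter theory of $G$, and let $N$ be an $\mathsf{S}$-normal subgroup of $G$. The following are equivalent: (1) $\mathsf{S}$ is a $\ast$-product over $N$; (2) for each $g\in G\setminus N$ and for each supercharacter $\chi\in\mathrm{Irr}(\mathsf{S})$ not containing $N$ in its kernel, $\chi(g)=0$; and, for each $g\in N$, there exists a supercharacter $\chi\in\mathrm{Irr}(\mathsf{S})$ satisfying $N\nsubseteq\ker(\chi)$ and $\chi(g)\neq0$; (3) $\mathbf{V}(\mathsf{S}\mid N)=N$.
   Context: All groups are finite. For $X\subseteq\mathrm{Irr}(G)$ write $\sigma_X=\sum_{\xi\in X}\xi(1)\xi$. A supercharacter theory $\mathsf{S}$ of $G$ is a subspace of the space of complex class functions of $G$ that is a unital subalgebra both for the pointwise product and for the convolution product $(\alpha\ast\beta)(g)=\frac{1}{|G|}\sum_{x\in G}\alpha(xg)\beta(x^{-1})$ (so it contains both identity elements). Equivalently, it is given by a partition $\mathrm{Cl}(\mathsf{S})$ of $G$ into "$\mathsf{S}$-classes" (superclasses) with $\{1\}\in\mathrm{Cl}(\mathsf{S})$, together with a partition $\mathcal{X}$ of $\mathrm{Irr}(G)$ with $|\mathcal{X}|=|\mathrm{Cl}(\mathsf{S})|$, such that each $\sigma_X$ ($X\in\mathcal{X}$) is constant on each $\mathsf{S}$-class; the subspace is the span of the $\sigma_X$. The set of supercharacters ($\mathsf{S}$-irreducible characters) is $\mathrm{Irr}(\mathsf{S})=\{\sigma_X: X\in\mathcal{X}\}$. A subgroup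 $N\le G$ is $\mathsf{S}$-normal if it is a union of $\mathsf{S}$-classes (it is then normal in $G$). For $\mathsf{S}$-normal $N$: $\mathsf{S}_N$ is the supercharacter theory of $N$ whose classes are the $\mathsf{S}$-classes contained in $N$; $\mathsf{S}_{G/N}$ is the supercharacter theory of $G/N$ whose classes are the images of the $\mathsf{S}$-classes under $G\to G/N$ and whose supercharacters are the $\chi\in\mathrm{Irr}(\mathsf{S})$ with $N\subseteq\ker\chi$, viewed as characters of $G/N$. $\mathrm{Irr}(\mathsf{S}\mid N)$ is the set of $\chi\in\mathrm{Irr}(\mathsf{S})$ with $N\nsubseteq\ker\chi$, and $\mathbf{V}(\mathsf{S}\mid N)$ is the subgroup of $G$ generated by all $g\in G$ for which there exists $\chi\in\mathrm{Irr}(\mathsf{S}\mid N)$ with $\chi(g)\ne0$. $\mathsf{S}$ is a $\ast$-product over the $\mathsf{S}$-normal subgroup $N$ if $\mathsf{S}=\mathsf{S}_N\ast\mathsf{S}_{G/N}$, where the latter is the supercharacter theory of $G$ whose classes are the $\mathsf{S}_N$-classes together with the preimages in $G$ of the $\mathsf{S}_{G/N}$-classes different from $\{N\}$ (the class of the identity of $G/N$); equivalently, every $\mathsf{S}$-class lying outside $N$ is a union of cosets of $N$.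
   Formalization: For N = {1}, condition (2) always fails (no supercharacter omits N from its kernel) while (1) and (3) hold, so it is proved that (1) and (3) are equivalent for every N, and that (2) is equivalent to (1) together with N ≠ {1}. *)

theory Defs
  imports
    "HOL-Algebra.Coset"
    "HOL-Algebra.Generated_Groups"
    "HOL-Library.Disjoint_Sets"
    "Jordan_Normal_Form.VS_Connect"
begin

section \<open>Complex characters of finite groups\<close>

definition mat_rep :: "('a, 'b) monoid_scheme \<Rightarrow> nat \<Rightarrow> ('a \<Rightarrow> complex mat) \<Rightarrow> bool" where
  "mat_rep G n \<rho> \<longleftrightarrow>
     (\<forall>g\<in>carrier G. \<rho> g \<in> carrier_mat n n) \<and>
     \<rho> \<one>\<^bsub>G\<^esub> = 1\<^sub>m n \<and>
     (\<forall>g\<in>carrier G. \<forall>h\<in>carrier G. \<rho> (g \<otimes>\<^bsub>G\<^esub> h) = \<rho> g * \<rho> h)"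

definition irreducible_rep :: "('a, 'b) monoid_scheme \<Rightarrow> nat \<Rightarrow> ('a \<Rightarrow> complex mat) \<Rightarrow> bool" where
  "irreducible_rep G n \<rho> \<longleftrightarrow>
     mat_rep G n \<rho> \<and> n > 0 \<and>
     (\<forall>W. subspace class_ring W (module_vec TYPE(complex) n) \<and>
          (\<forall>g\<in>carrier G. \<forall>w\<in>W. \<rho> g *\<^sub>v w \<in> W)
        \<longrightarrow> W = {0\<^sub>v n} \<or> W = carrier_vec n)"

text \<open>Throughout, a function on the group is represented by a function on the ambient type that
  vanishes outside the carrier, so that equality of such functions is HOL equality.\<close>

definition rep_char :: "('a, 'b) monoid_scheme \<Rightarrow> nat \<Rightarrow> ('a \<Rightarrow> complex mat) \<Rightarrow> 'a \<Rightarrow> complex" where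
  "rep_char G n \<rho> = (\<lambda>g. if g \<in> carrier G then \<Sum>i<n. \<rho> g $$ (i, i) else 0)"

definition Irr :: "('a, 'b) monoid_scheme \<Rightarrow> ('a \<Rightarrow> complex) set" where
  "Irr G = {rep_char G n \<rho> | n \<rho>. irreducible_rep G n \<rho>}"

definition char_ker :: "('a, 'b) monoid_scheme \<Rightarrow> ('a \<Rightarrow> complex) \<Rightarrow> 'a set" where
  "char_ker G \<chi> = {g \<in> carrier G. \<chi> g = \<chi> \<one>\<^bsub>G\<^esub>}"

definition class_functions :: "('a, 'b) monoid_scheme \<Rightarrow> ('a \<Rightarrow> complex) set" where
  "class_functions G =
     {f. (\<forall>g. g \<notin> carrier G \<longrightarrow> f g = 0) \<and>
         (\<forall>g\<in>carrier G. \<forall>x\<in>carrier G. f (x \<otimes>\<^bsub>G\<^esub> g \<otimes>\<^bsub>G\<^esub> inv\<^bsub>G\<^esub> x) = f g)}"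

definition convolution ::
  "('a, 'b) monoid_scheme \<Rightarrow> ('a \<Rightarrow> complex) \<Rightarrow> ('a \<Rightarrow> complex) \<Rightarrow> 'a \<Rightarrow> complex" where
  "convolution G \<alpha> \<beta> =
     (\<lambda>g. if g \<in> carrier G
           then (\<Sum>x\<in>carrier G. \<alpha> (x \<otimes>\<^bsub>G\<^esub> g) * \<beta> (inv\<^bsub>G\<^esub> x)) / of_nat (card (carrier G))
           else 0)"

section \<open>Supercharacter theories\<close>

text \<open>With the normalised convolution above, the convolution identity is \<open>|G|\<close> times the
  indicator function of the group identity.\<close>

definition supercharacter_theory :: "('a, 'b) monoid_scheme \<Rightarrow> ('a \<Rightarrow> complex) set \<Rightarrow> bool" where
  "supercharacter_theory G S \<longleftrightarrow>
     S \<subseteq> class_functions G \<and>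
     (\<forall>f\<in>S. \<forall>h\<in>S. (\<lambda>g. f g + h g) \<in> S) \<and>
     (\<forall>c. \<forall>f\<in>S. (\<lambda>g. c * f g) \<in> S) \<and>
     (\<forall>f\<in>S. \<forall>h\<in>S. (\<lambda>g. f g * h g) \<in> S) \<and>
     (\<forall>f\<in>S. \<forall>h\<in>S. convolution G f h \<in> S) \<and>
     (\<lambda>g. if g \<in> carrier G then 1 else 0) \<in> S \<and>
     (\<lambda>g. if g = \<one>\<^bsub>G\<^esub> then of_nat (card (carrier G)) else 0) \<in> S"

text \<open>The superclasses are the joint level sets of the members of \<open>S\<close>.\<close>

definition superclasses :: "('a, 'b) monoid_scheme \<Rightarrow> ('a \<Rightarrow> complex) set \<Rightarrow> 'a set set" where
  "superclasses G S =
     carrier G // {(g, h). g \<in> carrier G \<and> h \<in> carrier G \<and> (\<forall>f\<in>S. f g = f h)}"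

definition sigma_char ::
  "('a, 'b) monoid_scheme \<Rightarrow> ('a \<Rightarrow> complex) set \<Rightarrow> 'a \<Rightarrow> complex" where
  "sigma_char G X = (\<lambda>g. \<Sum>\<xi>\<in>X. \<xi> \<one>\<^bsub>G\<^esub> * \<xi> g)"

definition is_char_partition ::
  "('a, 'b) monoid_scheme \<Rightarrow> ('a \<Rightarrow> complex) set \<Rightarrow> ('a \<Rightarrow> complex) set set \<Rightarrow> bool" where
  "is_char_partition G S \<X> \<longleftrightarrow>
     partition_on (Irr G) \<X> \<and>
     card \<X> = card (superclasses G S) \<and>
     (\<forall>X\<in>\<X>. \<forall>K\<in>superclasses G S. \<forall>g\<in>K. \<forall>h\<in>K. sigma_char G X g = sigma_char G X h) \<and>
     S = {(\<lambda>g. \<Sum>X\<in>\<X>. c X * sigma_char G X g) | c. True}"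

text \<open>For a supercharacter theory of a finite group, the partition below exists and is unique
  (Diaconis and Isaacs).\<close>

definition char_partition ::
  "('a, 'b) monoid_scheme \<Rightarrow> ('a \<Rightarrow> complex) set \<Rightarrow> ('a \<Rightarrow> complex) set set" where
  "char_partition G S = (SOME \<X>. is_char_partition G S \<X>)"

definition supercharacters ::
  "('a, 'b) monoid_scheme \<Rightarrow> ('a \<Rightarrow> complex) set \<Rightarrow> ('a \<Rightarrow> complex) set" where
  "supercharacters G S = sigma_char G ` char_partition G S"

definition supernormal :: "('a, 'b) monoid_scheme \<Rightarrow> ('a \<Rightarrow> complex) set \<Rightarrow> 'a set \<Rightarrow> bool" where
  "supernormal G S N \<longleftrightarrow> subgroup N G \<and> (\<exists>C\<subseteq>superclasses G S. N = \<Union>C)"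

definition supercharacters_over ::
  "('a, 'b) monoid_scheme \<Rightarrow> ('a \<Rightarrow> complex) set \<Rightarrow> 'a set \<Rightarrow> ('a \<Rightarrow> complex) set" where
  "supercharacters_over G S N = {\<chi> \<in> supercharacters G S. \<not> N \<subseteq> char_ker G \<chi>}"

definition vanishing_off_subgroup ::
  "('a, 'b) monoid_scheme \<Rightarrow> ('a \<Rightarrow> complex) set \<Rightarrow> 'a set \<Rightarrow> 'a set" where
  "vanishing_off_subgroup G S N =
     generate G {g \<in> carrier G. \<exists>\<chi>\<in>supercharacters_over G S N. \<chi> g \<noteq> 0}"

section \<open>Products of supercharacter theories\<close>

text \<open>A supercharacter theory consists of all functions that are constant on its classes, so it is
  determined by its classes.\<close>

definition theory_of_classes :: "('a, 'b) monoid_scheme \<Rightarrow> 'a set set \<Rightarrow> ('a \<Rightarrow> complex) set" where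
  "theory_of_classes G \<K> =
     {f. (\<forall>g. g \<notin> carrier G \<longrightarrow> f g = 0) \<and> (\<forall>K\<in>\<K>. \<forall>g\<in>K. \<forall>h\<in>K. f g = f h)}"

definition theory_sub ::
  "('a, 'b) monoid_scheme \<Rightarrow> ('a \<Rightarrow> complex) set \<Rightarrow> 'a set \<Rightarrow> ('a \<Rightarrow> complex) set" where
  "theory_sub G S N = theory_of_classes (G\<lparr>carrier := N\<rparr>) {K \<in> superclasses G S. K \<subseteq> N}"

definition theory_quot ::
  "('a, 'b) monoid_scheme \<Rightarrow> ('a \<Rightarrow> complex) set \<Rightarrow> 'a set \<Rightarrow> ('a set \<Rightarrow> complex) set" where
  "theory_quot G S N =
     theory_of_classes (G Mod N) ((\<lambda>K. (\<lambda>g. N #>\<^bsub>G\<^esub> g) ` K) ` superclasses G S)"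

definition star_product ::
  "('a, 'b) monoid_scheme \<Rightarrow> 'a set \<Rightarrow> ('a \<Rightarrow> complex) set \<Rightarrow> ('a set \<Rightarrow> complex) set
    \<Rightarrow> ('a \<Rightarrow> complex) set" where
  "star_product G N T U =
     theory_of_classes G
       (superclasses (G\<lparr>carrier := N\<rparr>) T \<union>
        (\<lambda>L. {g \<in> carrier G. N #>\<^bsub>G\<^esub> g \<in> L}) ` (superclasses (G Mod N) U - {{N}}))"

definition is_star_product_over ::
  "('a, 'b) monoid_scheme \<Rightarrow> ('a \<Rightarrow> complex) set \<Rightarrow> 'a set \<Rightarrow> bool" where
  "is_star_product_over G S N \<longleftrightarrow> S = star_product G N (theory_sub G S N) (theory_quot G S N)"

end

theory Submission
  imports Defs "Jordan_Normal_Form.Spectral_Radius" "HOL-Library.Function_Algebras"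
begin

text \<open>All three conditions are about two kinds of supercharacters. Let \<open>\<nu>\<close> be \<open>|G|/|N|\<close> times the
  indicator of \<open>N\<close>. Convolution with \<open>\<nu>\<close> averages a class function over the cosets of \<open>N\<close>, and
  \<open>\<nu>\<close> belongs to \<open>S\<close> because \<open>N\<close> is a union of superclasses. The supercharacters are the
  primitive idempotents of the convolution algebra \<open>S\<close>, so convolution with \<open>\<nu>\<close> multiplies
  each of them by a scalar. If the scalar is nonzero, the supercharacter equals a multiple of its
  coset average, is constant on cosets of \<open>N\<close>, and has \<open>N\<close> in its kernel; if the scalar is
  zero, it sums to zero over every coset of \<open>N\<close>, which excludes \<open>N\<close> from its kernel
  (\<open>supercharacter_dichotomy\<close>).

  Now \<open>S\<close> is a star product over \<open>N\<close> exactly when every member of \<open>S\<close> is constant on the cosets of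
  \<open>N\<close> outside \<open>N\<close> (\<open>star_product_iff_coset_constant\<close>). A supercharacter of the second kind that is
  constant on a coset must vanish there, since it sums to zero. Conversely, if those of the second kind
  vanish off \<open>N\<close>, then every member of \<open>S\<close>, being a combination of supercharacters, is constant on
  the cosets outside \<open>N\<close> (\<open>coset_constant_iff_vanishing\<close>). It remains to see that for
  nontrivial \<open>N\<close> the supercharacters of the second kind have no common zero in \<open>N\<close>
  (\<open>supercharacter_nonzero_on_N\<close>): at a common zero, the regular character, which is the sum of all
  supercharacters, would agree with its average over \<open>N\<close>, and this is false on all of \<open>N\<close>.

  What makes these arguments available is the theorem of Diaconis and Isaacs that the partition of the
  irreducible characters exists (\<open>char_partition_exists\<close>). Both products make \<open>S\<close> a unital algebra of
  functions on a finite set: pointwise multiplication on the group, and convolution on the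
  irreducible characters, where a class function becomes the family of its coefficients. Such an algebra
  contains the indicators of its joint level sets (\<open>algebra_separates_points\<close>). Its level sets on the
  group are the superclasses, those on the irreducible characters form the partition, and
  their numbers agree because both families of indicators are bases of \<open>S\<close>.

  This in turn needs that convolution becomes multiplication of coefficients, that is, that the irreducible
  characters are orthogonal and span the class functions. Both follow from Schur's lemma for a
  single representation. A class function acts on an irreducible representation as a
  scalar, so that convolution with an irreducible character only rescales that character; with the
  norm computation and commutativity of convolution this gives orthogonality
  (\<open>char_coeff_Irr\<close>). For the spanning property, a nonzero class function acts as a nonzero matrix \<open>M\<close>
  on the regular representation, and it cannot annihilate an irreducible
  subrepresentation of the image of the conjugate transpose of \<open>M\<close>
  (\<open>nonzero_class_function_has_coefficient\<close>).\<close>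

section \<open>Subspaces as images of injective matrices\<close>

lemma subspace_vec_iff:
  "VectorSpace.subspace class_ring W (module_vec TYPE(complex) n) \<longleftrightarrow>
     W \<subseteq> carrier_vec n \<and> 0\<^sub>v n \<in> W \<and> (\<forall>u\<in>W. \<forall>v\<in>W. u + v \<in> W) \<and> (\<forall>c. \<forall>v\<in>W. c \<cdot>\<^sub>v v \<in> W)"
  unfolding VectorSpace.subspace_def submodule_def using vec_vs[of n] vec_module[of n]
  by (auto simp: module_vec_simps class_ring_simps)

lemma mult_mat_entry:
  assumes "A \<in> carrier_mat n m" "B \<in> carrier_mat m l" "i < n" "j < l"
  shows "(A * B) $$ (i,j) = (\<Sum>p<m. A $$ (i,p) * B $$ (p,j))"
  using assms by (auto simp: scalar_prod_def atLeast0LessThan intro!: sum.cong)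

text \<open>An injective matrix whose image is a subspace plays the role of a basis of that subspace:
  coordinates with respect to it are again vectors, so that a representation on an invariant subspace can be
  written as a matrix representation.\<close>
definition injective_mat :: "complex mat \<Rightarrow> bool" where
  "injective_mat C \<longleftrightarrow>
     (\<forall>v\<in>carrier_vec (dim_col C). C *\<^sub>v v = 0\<^sub>v (dim_row C) \<longrightarrow> v = 0\<^sub>v (dim_col C))"

lemma injective_matD:
  assumes "injective_mat C" "C \<in> carrier_mat n k" "v \<in> carrier_vec k" "C *\<^sub>v v = 0\<^sub>v n"
  shows "v = 0\<^sub>v k"
  using assms unfolding injective_mat_def by auto

lemma injective_matI:
  assumes "C \<in> carrier_mat n k" "\<And>v. v \<in> carrier_vec k \<Longrightarrow> C *\<^sub>v v = 0\<^sub>v n \<Longrightarrow> v = 0\<^sub>v k"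
  shows "injective_mat C"
  using assms unfolding injective_mat_def by auto

text \<open>With more columns than rows, padding by zero rows gives a singular square matrix, and
  a vector in its kernel is also in the kernel of the original matrix.\<close>
lemma injective_mat_cols_le_rows:
  assumes C: "C \<in> carrier_mat n k" and inj: "injective_mat C"
  shows "k \<le> n"
proof (rule ccontr)
  assume "\<not> k \<le> n"
  then have nk: "n < k" by simp
  define D where "D = mat k k (\<lambda>(i,j). if i < n then C $$ (i,j) else 0)"
  have D: "D \<in> carrier_mat k k" unfolding D_def by simp
  \<comment> \<open>The last row of \<open>D\<close> is zero, so \<open>D\<close> is singular.\<close>
  have "D\<^sup>T *\<^sub>v unit_vec k (k - 1) = 0\<^sub>v k"
  proof (rule eq_vecI)
    fix i assume "i < dim_vec (0\<^sub>v k :: complex vec)"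
    then show "(D\<^sup>T *\<^sub>v unit_vec k (k - 1)) $ i = 0\<^sub>v k $ i"
      using nk by (auto simp: D_def)
  qed (use D in auto)
  moreover have "unit_vec k (k - 1) \<noteq> (0\<^sub>v k :: complex vec)"
  proof
    assume "unit_vec k (k - 1) = (0\<^sub>v k :: complex vec)"
    then have "unit_vec k (k - 1) $ (k - 1) = (0\<^sub>v k :: complex vec) $ (k - 1)" by simp
    then show False using nk by simp
  qed
  ultimately have "det D\<^sup>T = 0"
    using D by (subst det_0_iff_vec_prod_zero_field[of _ k]) (auto intro!: exI[of _ "unit_vec k (k - 1)"])
  then have "det D = 0" using det_transpose[OF D] by simp
  then obtain v where v: "v \<in> carrier_vec k" "v \<noteq> 0\<^sub>v k" "D *\<^sub>v v = 0\<^sub>v k"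
    using det_0_iff_vec_prod_zero_field[OF D] by auto
  have "C *\<^sub>v v = 0\<^sub>v n"
  proof (rule eq_vecI)
    fix i assume "i < dim_vec (0\<^sub>v n :: complex vec)"
    then have i: "i < n" by simp
    have "row C i = row D i" using C i nk by (auto simp: D_def)
    moreover have "(D *\<^sub>v v) $ i = 0" using v(3) i nk by simp
    ultimately show "(C *\<^sub>v v) $ i = 0\<^sub>v n $ i" using C D i nk by simp
  qed (use C in auto)
  then show False using injective_matD[OF inj C v(1)] v(2) by simp
qed

lemma injective_square_mat_surj:
  assumes C: "C \<in> carrier_mat n n" and inj: "injective_mat C" and w: "w \<in> carrier_vec n"
  shows "\<exists>v\<in>carrier_vec n. C *\<^sub>v v = w"
proof -
  have "det C \<noteq> 0"
    using det_0_iff_vec_prod_zero_field[OF C] injective_matD[OF inj C] by blast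
  from det_non_zero_imp_unit[OF C this, of "()"]
  obtain B where B: "B \<in> carrier_mat n n" "C * B = 1\<^sub>m n"
    unfolding Units_def by (auto simp: ring_mat_simps)
  have "C *\<^sub>v (B *\<^sub>v w) = w"
    using assoc_mult_mat_vec[OF C B(1) w] B(2) w by simp
  then show ?thesis using B(1) w by (intro bexI[of _ "B *\<^sub>v w"]) auto
qed

lemma injective_mat_left_cancel:
  assumes C: "C \<in> carrier_mat n k" and inj: "injective_mat C"
    and A: "A \<in> carrier_mat k l" and B: "B \<in> carrier_mat k l" and eq: "C * A = C * B"
  shows "A = B"
proof (rule eq_matI)
  fix i j assume ij: "i < dim_row B" "j < dim_col B"
  have "C *\<^sub>v (col A j - col B j) = C *\<^sub>v col A j - C *\<^sub>v col B j"
    using C A B ij by (intro mult_minus_distrib_mat_vec) auto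
  also have "C *\<^sub>v col A j = col (C * A) j" using C A B ij by (intro eq_vecI) auto
  also have "C *\<^sub>v col B j = col (C * B) j" using C A B ij by (intro eq_vecI) auto
  finally have "C *\<^sub>v (col A j - col B j) = 0\<^sub>v n" using eq C B ij by auto
  then have "col A j - col B j = 0\<^sub>v k"
    using A B ij by (intro injective_matD[OF inj C]) auto
  then have "(col A j - col B j) $ i = 0" using ij B by simp
  then show "A $$ (i,j) = B $$ (i,j)" using ij A B by simp
qed (use A B in auto)

text \<open>Among the injective matrices with image inside \<open>W\<close>, take one with the most columns. If its image
  missed a vector of \<open>W\<close>, appending that vector as a further column would keep it injective.\<close>
lemma subspace_basis_mat:
  assumes W: "VectorSpace.subspace class_ring W (module_vec TYPE(complex) n)"
  obtains k C where "C \<in> carrier_mat n k" "injective_mat C" "W = (\<lambda>v. C *\<^sub>v v) ` carrier_vec k"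
proof -
  note W' = W[unfolded subspace_vec_iff]
  define P where "P k \<longleftrightarrow> (\<exists>C\<in>carrier_mat n k. injective_mat C \<and> (\<forall>v\<in>carrier_vec k. C *\<^sub>v v \<in> W))" for k
  have "P 0"
  proof -
    have "mat n 0 (\<lambda>_. 0 :: complex) *\<^sub>v v = 0\<^sub>v n" if "v \<in> carrier_vec 0" for v
      using that by (intro eq_vecI) (auto simp: scalar_prod_def)
    then show ?thesis unfolding P_def using W'
      by (intro bexI[of _ "mat n 0 (\<lambda>_. 0)"]) (auto intro!: injective_matI[of _ n 0])
  qed
  moreover have "\<forall>k. P k \<longrightarrow> k \<le> n" unfolding P_def using injective_mat_cols_le_rows by blast
  ultimately obtain k where k: "P k" "\<And>l. P l \<Longrightarrow> l \<le> k"
    using GreatestI_nat[of P 0 n] Greatest_le_nat[of P _ n] by blast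
  from k(1) obtain C where C: "C \<in> carrier_mat n k" and inj: "injective_mat C"
    and CW: "\<And>v. v \<in> carrier_vec k \<Longrightarrow> C *\<^sub>v v \<in> W" unfolding P_def by blast
  have "w \<in> (\<lambda>v. C *\<^sub>v v) ` carrier_vec k" if w: "w \<in> W" for w
  proof (rule ccontr)
    assume nw: "w \<notin> (\<lambda>v. C *\<^sub>v v) ` carrier_vec k"
    have wn: "w \<in> carrier_vec n" using w W' by auto
    define D where "D = mat n (Suc k) (\<lambda>(i,j). if j < k then C $$ (i,j) else w $ i)"
    have D: "D \<in> carrier_mat n (Suc k)" unfolding D_def by simp
    have split: "D *\<^sub>v v = C *\<^sub>v vec k (\<lambda>i. v $ i) + v $ k \<cdot>\<^sub>v w" if v: "v \<in> carrier_vec (Suc k)" for v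
    proof (rule eq_vecI)
      fix i assume "i < dim_vec (C *\<^sub>v vec k (\<lambda>i. v $ i) + v $ k \<cdot>\<^sub>v w)"
      then have "i < n" using C wn by simp
      then show "(D *\<^sub>v v) $ i = (C *\<^sub>v vec k (\<lambda>i. v $ i) + v $ k \<cdot>\<^sub>v w) $ i"
        using v C wn by (auto simp: D_def scalar_prod_def intro!: sum.cong)
    qed (use C D wn in auto)
    have "D *\<^sub>v v \<in> W" if "v \<in> carrier_vec (Suc k)" for v
      unfolding split[OF that] using CW W' w by auto
    moreover have "injective_mat D"
    proof (rule injective_matI[OF D])
      fix v assume v: "v \<in> carrier_vec (Suc k)" and 0: "D *\<^sub>v v = 0\<^sub>v n"
      define u where "u = vec k (\<lambda>i. v $ i)"
      have u: "u \<in> carrier_vec k" unfolding u_def by simp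
      have eq: "C *\<^sub>v u + v $ k \<cdot>\<^sub>v w = 0\<^sub>v n" using split[OF v] 0 u_def by simp
      have vk: "v $ k = 0"
      proof (rule ccontr)
        assume a: "v $ k \<noteq> 0"
        have "C *\<^sub>v ((- 1 / v $ k) \<cdot>\<^sub>v u) = (- 1 / v $ k) \<cdot>\<^sub>v (C *\<^sub>v u)"
          using C u by (rule mult_mat_vec)
        also have "\<dots> = w"
        proof (rule eq_vecI)
          fix i assume i: "i < dim_vec w"
          have "(C *\<^sub>v u + v $ k \<cdot>\<^sub>v w) $ i = 0" using eq i wn by simp
          then have "(C *\<^sub>v u) $ i = - (v $ k * w $ i)" using i C wn u
            by (simp add: eq_neg_iff_add_eq_0)
          then show "((- 1 / v $ k) \<cdot>\<^sub>v (C *\<^sub>v u)) $ i = w $ i"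
            using i C wn a by simp
        qed (use C wn in auto)
        finally show False using nw u by (metis imageI smult_carrier_vec)
      qed
      have "v $ k \<cdot>\<^sub>v w = 0\<^sub>v n" using vk wn by (intro eq_vecI) auto
      then have "C *\<^sub>v u = 0\<^sub>v n" using eq C u by simp
      then have "u = 0\<^sub>v k" using injective_matD[OF inj C u] by simp
      then have "v $ i = 0" if "i < k" for i using that unfolding u_def
        by (metis index_vec index_zero_vec(1))
      then show "v = 0\<^sub>v (Suc k)" using v vk by (intro eq_vecI) (auto simp: less_Suc_eq)
    qed
    ultimately have "P (Suc k)" unfolding P_def using D by blast
    then show False using k(2) by fastforce
  qed
  then have "W = (\<lambda>v. C *\<^sub>v v) ` carrier_vec k" using CW by auto
  then show ?thesis using that C inj by blast
qed

text \<open>The squared norm of \<open>M' w\<close> is the inner product of \<open>w\<close> with \<open>M (M' w)\<close>, for \<open>M'\<close> the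
  conjugate transpose of \<open>M\<close>. Hence \<open>M\<close> is injective on the image of \<open>M'\<close>.\<close>
lemma conjugate_transpose_kernel:
  fixes M M' :: "complex mat"
  assumes M: "M \<in> carrier_mat m m" and M': "M' \<in> carrier_mat m m"
    and adj: "\<And>i j. i < m \<Longrightarrow> j < m \<Longrightarrow> M' $$ (i,j) = cnj (M $$ (j,i))"
    and w: "w \<in> carrier_vec m" and 0: "M *\<^sub>v (M' *\<^sub>v w) = 0\<^sub>v m"
  shows "M' *\<^sub>v w = 0\<^sub>v m"
proof -
  define u where "u = M' *\<^sub>v w"
  have u: "u \<in> carrier_vec m" using M' w unfolding u_def by simp
  have ui: "u $ i = (\<Sum>j<m. M' $$ (i,j) * w $ j)" if "i < m" for i
    using that M' w by (auto simp: u_def scalar_prod_def atLeast0LessThan intro!: sum.cong)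
  have Mu: "(\<Sum>i<m. M $$ (j,i) * u $ i) = 0" if j: "j < m" for j
  proof -
    have "(\<Sum>i<m. M $$ (j,i) * u $ i) = (M *\<^sub>v u) $ j"
      using j M u by (auto simp: scalar_prod_def atLeast0LessThan intro!: sum.cong)
    then show ?thesis using 0 j unfolding u_def by simp
  qed
  have "(\<Sum>i<m. cnj (u $ i) * u $ i) = (\<Sum>i<m. \<Sum>j<m. cnj (w $ j) * (M $$ (j,i) * u $ i))"
    by (intro sum.cong) (auto simp: ui adj sum_distrib_left sum_distrib_right cnj_sum mult_ac)
  also have "\<dots> = (\<Sum>j<m. cnj (w $ j) * (\<Sum>i<m. M $$ (j,i) * u $ i))"
    unfolding sum_distrib_left by (rule sum.swap)
  also have "\<dots> = 0" using Mu by simp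
  finally have "of_real (\<Sum>i<m. (cmod (u $ i))\<^sup>2) = (0 :: complex)"
    unfolding of_real_sum by (subst (asm) mult.commute) (simp only: complex_norm_square)
  then have "(\<Sum>i<m. (cmod (u $ i))\<^sup>2) = 0" using of_real_eq_0_iff by blast
  then have "u $ i = 0" if "i < m" for i using that by (simp add: sum_nonneg_eq_0_iff)
  then show ?thesis using M' unfolding u_def by (intro eq_vecI) auto
qed

section \<open>Matrix representations and Schur's lemma\<close>

lemma mat_repD:
  assumes "mat_rep G n \<rho>"
  shows "g \<in> carrier G \<Longrightarrow> \<rho> g \<in> carrier_mat n n" "\<rho> \<one>\<^bsub>G\<^esub> = 1\<^sub>m n"
    "g \<in> carrier G \<Longrightarrow> h \<in> carrier G \<Longrightarrow> \<rho> (g \<otimes>\<^bsub>G\<^esub> h) = \<rho> g * \<rho> h"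
  using assms unfolding mat_rep_def by auto

lemma mat_rep_mult_entry:
  assumes "mat_rep G n \<rho>" "g \<in> carrier G" "h \<in> carrier G" "i < n" "j < n"
  shows "\<rho> (g \<otimes>\<^bsub>G\<^esub> h) $$ (i, j) = (\<Sum>p<n. \<rho> g $$ (i, p) * \<rho> h $$ (p, j))"
  using assms mat_repD(1)[OF assms(1,2)] mat_repD(1)[OF assms(1,3)]
  by (auto simp: mat_repD(3)[OF assms(1)] scalar_prod_def atLeast0LessThan intro!: sum.cong)

text \<open>Each \<open>\<rho> g\<close> maps the columns of \<open>C\<close> into \<open>W\<close>, hence to combinations of the columns of \<open>C\<close>; the
  coefficients form \<open>\<tau> g\<close>. They are unique since \<open>C\<close> is injective, and uniqueness gives the
  homomorphism property.\<close>
lemma invariant_subspace_subrep: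
  assumes "group G" and rep: "mat_rep G n \<rho>"
    and W: "VectorSpace.subspace class_ring W (module_vec TYPE(complex) n)"
    and inv: "\<And>g w. g \<in> carrier G \<Longrightarrow> w \<in> W \<Longrightarrow> \<rho> g *\<^sub>v w \<in> W"
  obtains k C \<tau> where "C \<in> carrier_mat n k" "injective_mat C" "W = (\<lambda>v. C *\<^sub>v v) ` carrier_vec k"
    "mat_rep G k \<tau>" "\<And>g. g \<in> carrier G \<Longrightarrow> \<rho> g * C = C * \<tau> g"
proof -
  interpret group G by fact
  obtain k C where C: "C \<in> carrier_mat n k" and inj: "injective_mat C"
    and WC: "W = (\<lambda>v. C *\<^sub>v v) ` carrier_vec k" using subspace_basis_mat[OF W] .
  note \<rho> = mat_repD[OF rep]
  have ex: "\<exists>T\<in>carrier_mat k k. \<rho> g * C = C * T" if g: "g \<in> carrier G" for g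
  proof -
    have "\<exists>t\<in>carrier_vec k. \<rho> g *\<^sub>v col C j = C *\<^sub>v t" if j: "j < k" for j
    proof -
      have "C *\<^sub>v unit_vec k j = col C j" using C j by (intro eq_vecI) auto
      then have "col C j \<in> W" unfolding WC by (metis imageI unit_vec_carrier)
      then show ?thesis using inv[OF g] WC by blast
    qed
    then obtain t where t: "\<And>j. j < k \<Longrightarrow> t j \<in> carrier_vec k \<and> \<rho> g *\<^sub>v col C j = C *\<^sub>v t j"
      by metis
    define T where "T = mat k k (\<lambda>(i,j). t j $ i)"
    have T: "T \<in> carrier_mat k k" unfolding T_def by simp
    have "\<rho> g * C = C * T"
    proof (rule eq_matI)
      fix i j assume "i < dim_row (C * T)" "j < dim_col (C * T)"
      then have ij: "i < n" "j < k" using C T by auto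
      have "col T j = t j" using t[OF ij(2)] ij unfolding T_def by (intro eq_vecI) auto
      moreover have "(\<rho> g *\<^sub>v col C j) $ i = (C *\<^sub>v t j) $ i" using t[OF ij(2)] by simp
      ultimately show "(\<rho> g * C) $$ (i,j) = (C * T) $$ (i,j)"
        using ij C T \<rho>(1)[OF g] by simp
    qed (use C T \<rho>(1)[OF g] in auto)
    then show ?thesis using T by blast
  qed
  then obtain \<tau> where \<tau>: "\<And>g. g \<in> carrier G \<Longrightarrow> \<tau> g \<in> carrier_mat k k \<and> \<rho> g * C = C * \<tau> g"
    by metis
  have "\<tau> \<one>\<^bsub>G\<^esub> = 1\<^sub>m k"
  proof (rule injective_mat_left_cancel[OF C inj])
    show "C * \<tau> \<one>\<^bsub>G\<^esub> = C * 1\<^sub>m k" using \<tau>[OF one_closed] \<rho>(2) C by auto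
  qed (use \<tau>[OF one_closed] in auto)
  moreover have "\<tau> (g \<otimes>\<^bsub>G\<^esub> h) = \<tau> g * \<tau> h" if gh: "g \<in> carrier G" "h \<in> carrier G" for g h
  proof (rule injective_mat_left_cancel[OF C inj])
    note g = \<tau>[OF gh(1)] and h = \<tau>[OF gh(2)]
    have "C * \<tau> (g \<otimes>\<^bsub>G\<^esub> h) = \<rho> g * \<rho> h * C" using \<tau>[of "g \<otimes>\<^bsub>G\<^esub> h"] gh \<rho>(3) by auto
    also have "\<dots> = \<rho> g * (C * \<tau> h)" using \<rho>(1)[OF gh(1)] \<rho>(1)[OF gh(2)] C h
      by (metis assoc_mult_mat)
    also have "\<dots> = C * \<tau> g * \<tau> h" using \<rho>(1)[OF gh(1)] C g h by (metis assoc_mult_mat)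
    also have "\<dots> = C * (\<tau> g * \<tau> h)" using C g h by (metis assoc_mult_mat)
    finally show "C * \<tau> (g \<otimes>\<^bsub>G\<^esub> h) = C * (\<tau> g * \<tau> h)" .
  qed (use \<tau> gh in \<open>auto intro!: mult_carrier_mat[of _ k k]\<close>)
  ultimately have "mat_rep G k \<tau>" unfolding mat_rep_def using \<tau> by auto
  then show ?thesis using that C inj WC \<tau> by blast
qed

text \<open>Induction on the dimension, which drops on passing to a proper invariant subspace.\<close>
lemma exists_irreducible_subrep:
  assumes "group G"
  shows "mat_rep G n \<rho> \<Longrightarrow> n > 0 \<Longrightarrow> \<exists>k C \<tau>. C \<in> carrier_mat n k \<and> injective_mat C \<and>
    irreducible_rep G k \<tau> \<and> (\<forall>g\<in>carrier G. \<rho> g * C = C * \<tau> g)"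
proof (induction n arbitrary: \<rho> rule: less_induct)
  case (less n)
  note \<rho> = mat_repD[OF less.prems(1)]
  show ?case
  proof (cases "irreducible_rep G n \<rho>")
    case True
    have "injective_mat (1\<^sub>m n)" by (rule injective_matI[of _ n n]) auto
    moreover have "\<rho> g * 1\<^sub>m n = 1\<^sub>m n * \<rho> g" if "g \<in> carrier G" for g using \<rho>(1)[OF that] by simp
    ultimately show ?thesis using True
      by (intro exI[of _ n] exI[of _ "1\<^sub>m n"] exI[of _ \<rho>]) auto
  next
    case False
    then obtain W where W: "VectorSpace.subspace class_ring W (module_vec TYPE(complex) n)"
      and inv: "\<And>g w. g \<in> carrier G \<Longrightarrow> w \<in> W \<Longrightarrow> \<rho> g *\<^sub>v w \<in> W"
      and ne: "W \<noteq> {0\<^sub>v n}" "W \<noteq> carrier_vec n"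
      using less.prems unfolding irreducible_rep_def by blast
    obtain k C \<tau> where C: "C \<in> carrier_mat n k" "injective_mat C"
      and WC: "W = (\<lambda>v. C *\<^sub>v v) ` carrier_vec k" and \<tau>: "mat_rep G k \<tau>"
      and int: "\<And>g. g \<in> carrier G \<Longrightarrow> \<rho> g * C = C * \<tau> g"
      by (rule invariant_subspace_subrep[OF assms less.prems(1) W inv]) (assumption | rule that)+
    have "k \<noteq> 0"
    proof
      assume "k = 0"
      then have "C *\<^sub>v v = 0\<^sub>v n" if "v \<in> carrier_vec k" for v
        using C(1) that by (intro eq_vecI) (auto simp: scalar_prod_def)
      then have "W \<subseteq> {0\<^sub>v n}" using WC by auto
      then show False using ne(1) W[unfolded subspace_vec_iff] by auto
    qed
    moreover have "k \<noteq> n"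
      using injective_square_mat_surj[of C n] C WC ne(2) W[unfolded subspace_vec_iff] by blast
    ultimately have "k < n" "k > 0" using injective_mat_cols_le_rows[OF C] by auto
    from less.IH[OF this(1) \<tau> this(2)] obtain l D \<upsilon> where D: "D \<in> carrier_mat k l" "injective_mat D"
      and \<upsilon>: "irreducible_rep G l \<upsilon>" and int': "\<And>g. g \<in> carrier G \<Longrightarrow> \<tau> g * D = D * \<upsilon> g" by blast
    have "injective_mat (C * D)"
    proof (rule injective_matI[of _ n l])
      fix v assume v: "v \<in> carrier_vec l" "C * D *\<^sub>v v = 0\<^sub>v n"
      then have "C *\<^sub>v (D *\<^sub>v v) = 0\<^sub>v n" using assoc_mult_mat_vec[OF C(1) D(1) v(1)] by simp
      then have "D *\<^sub>v v = 0\<^sub>v k" using injective_matD[OF C(2,1)] D(1) v(1) by simp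
      then show "v = 0\<^sub>v l" using injective_matD[OF D(2,1)] v(1) by simp
    qed (use C D in auto)
    moreover have "\<rho> g * (C * D) = C * D * \<upsilon> g" if g: "g \<in> carrier G" for g
    proof -
      have m: "\<upsilon> g \<in> carrier_mat l l" "\<tau> g \<in> carrier_mat k k" "\<rho> g \<in> carrier_mat n n"
        using \<upsilon> \<tau> g \<rho>(1) unfolding irreducible_rep_def mat_rep_def by auto
      have "\<rho> g * (C * D) = C * \<tau> g * D" using m C D int[OF g] by (metis assoc_mult_mat)
      also have "\<dots> = C * (D * \<upsilon> g)" using m C D int'[OF g] by (metis assoc_mult_mat)
      also have "\<dots> = C * D * \<upsilon> g" using m C D by (metis assoc_mult_mat)
      finally show ?thesis .
    qed
    ultimately show ?thesis using C D \<upsilon>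
      by (intro exI[of _ l] exI[of _ "C * D"] exI[of _ \<upsilon>]) auto
  qed
qed

lemma irreducible_repD:
  assumes "irreducible_rep G n \<rho>"
  shows "mat_rep G n \<rho>" "n > 0"
  using assms unfolding irreducible_rep_def by auto

text \<open>An eigenspace of \<open>A\<close> is a nonzero invariant subspace, hence everything.\<close>
lemma schur_scalar:
  assumes irr: "irreducible_rep G n \<rho>" and A: "A \<in> carrier_mat n n"
    and comm: "\<And>g. g \<in> carrier G \<Longrightarrow> \<rho> g * A = A * \<rho> g"
  obtains c where "A = c \<cdot>\<^sub>m 1\<^sub>m n"
proof -
  note \<rho> = mat_repD[OF irreducible_repD(1)[OF irr]]
  have "spectrum A \<noteq> {}" using spectrum_non_empty[OF A irreducible_repD(2)[OF irr]] .
  then obtain c u where u: "u \<in> carrier_vec n" "u \<noteq> 0\<^sub>v n" "A *\<^sub>v u = c \<cdot>\<^sub>v u"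
    using A unfolding spectrum_def eigenvalue_def eigenvector_def by auto
  define W where "W = {v \<in> carrier_vec n. A *\<^sub>v v = c \<cdot>\<^sub>v v}"
  have "VectorSpace.subspace class_ring W (module_vec TYPE(complex) n)"
    unfolding subspace_vec_iff W_def
  proof (intro conjI ballI allI)
    show "0\<^sub>v n \<in> {v \<in> carrier_vec n. A *\<^sub>v v = c \<cdot>\<^sub>v v}" using A by (auto intro!: eq_vecI)
  next
    fix x y assume "x \<in> {v \<in> carrier_vec n. A *\<^sub>v v = c \<cdot>\<^sub>v v}" "y \<in> {v \<in> carrier_vec n. A *\<^sub>v v = c \<cdot>\<^sub>v v}"
    then show "x + y \<in> {v \<in> carrier_vec n. A *\<^sub>v v = c \<cdot>\<^sub>v v}"
      using A by (auto simp: mult_add_distrib_mat_vec smult_add_distrib_vec[symmetric])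
  next
    fix d x assume "x \<in> {v \<in> carrier_vec n. A *\<^sub>v v = c \<cdot>\<^sub>v v}"
    then show "d \<cdot>\<^sub>v x \<in> {v \<in> carrier_vec n. A *\<^sub>v v = c \<cdot>\<^sub>v v}"
      using A by (auto simp: mult_mat_vec[OF A] smult_smult_assoc mult.commute)
  qed auto
  moreover have "\<rho> g *\<^sub>v w \<in> W" if g: "g \<in> carrier G" and w: "w \<in> W" for g w
  proof -
    have w': "w \<in> carrier_vec n" "A *\<^sub>v w = c \<cdot>\<^sub>v w" using w unfolding W_def by auto
    have "A *\<^sub>v (\<rho> g *\<^sub>v w) = \<rho> g *\<^sub>v (A *\<^sub>v w)"
      using assoc_mult_mat_vec[OF A \<rho>(1)[OF g] w'(1)] assoc_mult_mat_vec[OF \<rho>(1)[OF g] A w'(1)]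
        comm[OF g] by simp
    also have "\<dots> = c \<cdot>\<^sub>v (\<rho> g *\<^sub>v w)" using w' mult_mat_vec[OF \<rho>(1)[OF g] w'(1)] by simp
    finally show ?thesis using \<rho>(1)[OF g] w' unfolding W_def by auto
  qed
  moreover have "W \<noteq> {0\<^sub>v n}" using u unfolding W_def by auto
  ultimately have "W = carrier_vec n" using irr unfolding irreducible_rep_def by blast
  then have all: "A *\<^sub>v v = c \<cdot>\<^sub>v v" if "v \<in> carrier_vec n" for v using that unfolding W_def by auto
  have "A = c \<cdot>\<^sub>m 1\<^sub>m n"
  proof (rule eq_matI)
    fix i j assume "i < dim_row (c \<cdot>\<^sub>m 1\<^sub>m n)" "j < dim_col (c \<cdot>\<^sub>m 1\<^sub>m n)"
    then have ij: "i < n" "j < n" by auto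
    have "(A *\<^sub>v unit_vec n j) $ i = (c \<cdot>\<^sub>v unit_vec n j) $ i" using all[of "unit_vec n j"] by simp
    then show "A $$ (i,j) = (c \<cdot>\<^sub>m 1\<^sub>m n) $$ (i,j)" using ij A by auto
  qed (use A in auto)
  then show ?thesis using that by blast
qed

section \<open>Functions with a dual family, and algebras of functions on a finite set\<close>

lemma sum_fun_apply: "(\<Sum>i\<in>I. f i) x = (\<Sum>i\<in>I. f i x :: complex)"
  by (induction I rule: infinite_finite_induct) auto

text \<open>The functionals \<open>\<phi> a\<close> detect the coefficients of a linear combination of members of \<open>A\<close>, so \<open>A\<close> is
  linearly independent and no larger than a spanning family. The irreducible characters, the supercharacters and the
  indicators of superclasses all carry such functionals.\<close>
lemma biorthogonal_functions_card_le:
  fixes A :: "('x \<Rightarrow> complex) set" and b :: "'j \<Rightarrow> 'x \<Rightarrow> complex"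
    and \<phi> :: "('x \<Rightarrow> complex) \<Rightarrow> ('x \<Rightarrow> complex) \<Rightarrow> complex"
  assumes J: "finite J"
    and span: "\<And>a. a \<in> A \<Longrightarrow> \<exists>c. a = (\<lambda>x. \<Sum>j\<in>J. c j * b j x)"
    and linear: "\<And>a F c. a \<in> A \<Longrightarrow> F \<subseteq> A \<Longrightarrow> \<phi> a (\<lambda>x. \<Sum>v\<in>F. c v * v x) = (\<Sum>v\<in>F. c v * \<phi> a v)"
    and diag: "\<And>a. a \<in> A \<Longrightarrow> \<phi> a a \<noteq> 0"
    and off_diag: "\<And>a v. a \<in> A \<Longrightarrow> v \<in> A \<Longrightarrow> a \<noteq> v \<Longrightarrow> \<phi> a v = 0"
  shows "finite A \<and> card A \<le> card J"
proof -
  interpret vector_space "\<lambda>(c::complex) (f :: 'x \<Rightarrow> complex) x. c * f x"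
    by unfold_locales (auto simp: fun_eq_iff algebra_simps)
  have "\<not> dependent A"
  proof
    assume "dependent A"
    then obtain F c a where F: "finite F" "F \<subseteq> A" "a \<in> F" "c a \<noteq> 0"
      and "(\<Sum>v\<in>F. (\<lambda>x. c v * v x)) = 0"
      unfolding dependent_explicit by blast
    then have "(\<lambda>x. \<Sum>v\<in>F. c v * v x) = (\<lambda>x. \<Sum>v\<in>{}. c v * v x)"
      by (simp add: fun_eq_iff sum_fun_apply)
    then have "(\<Sum>v\<in>F. c v * \<phi> a v) = (\<Sum>v\<in>{}. c v * \<phi> a v)"
      using linear[of a F c] linear[of a "{}" c] F(2,3) by auto
    also have "(\<Sum>v\<in>F. c v * \<phi> a v) = (\<Sum>v\<in>F. if v = a then c a * \<phi> a a else 0)"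
      using F(2,3) off_diag by (intro sum.cong) auto
    also have "\<dots> = c a * \<phi> a a" using F by simp
    finally show False using F diag by auto
  qed
  moreover have "A \<subseteq> span (b ` J)"
  proof
    fix a assume "a \<in> A"
    then obtain c where c: "a = (\<lambda>x. \<Sum>j\<in>J. c j * b j x)" using span by blast
    have "a = (\<Sum>j\<in>J. (\<lambda>x. c j * b j x))" unfolding c by (simp add: fun_eq_iff sum_fun_apply)
    also have "\<dots> \<in> span (b ` J)" by (intro span_sum span_scale span_base) auto
    finally show "a \<in> span (b ` J)" .
  qed
  ultimately have "finite A \<and> card A \<le> card (b ` J)"
    using independent_span_bound[of "b ` J" A] J by blast
  then show ?thesis using card_image_le[OF J, of b] by linarith
qed

text \<open>Indicators of joint level sets by Lagrange interpolation: for each point \<open>k\<close>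
  separated from \<open>i\<close> by some \<open>f\<close> there is the factor \<open>(f - f k) / (f i - f k)\<close>, which is
  \<open>1\<close> at \<open>i\<close> and \<open>0\<close> at \<open>k\<close>. All closure conditions are required on \<open>I\<close> only, so that
  the lemma applies to functions restricted to the irreducible characters.\<close>
lemma algebra_separates_points:
  fixes T :: "('i \<Rightarrow> complex) set"
  assumes I: "finite I" and i: "i \<in> I"
    and one: "\<exists>u\<in>T. \<forall>j\<in>I. u j = 1"
    and add: "\<And>f h. f \<in> T \<Longrightarrow> h \<in> T \<Longrightarrow> \<exists>u\<in>T. \<forall>j\<in>I. u j = f j + h j"
    and scale: "\<And>c f. f \<in> T \<Longrightarrow> \<exists>u\<in>T. \<forall>j\<in>I. u j = c * f j"
    and mult: "\<And>f h. f \<in> T \<Longrightarrow> h \<in> T \<Longrightarrow> \<exists>u\<in>T. \<forall>j\<in>I. u j = f j * h j"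
  shows "\<exists>u\<in>T. \<forall>j\<in>I. u j = (if \<forall>f\<in>T. f i = f j then 1 else 0)"
proof -
  define B where "B = {j \<in> I. \<exists>f\<in>T. f i \<noteq> f j}"
  have "finite B" using I unfolding B_def by simp
  moreover have "B \<subseteq> I" "\<forall>j\<in>B. \<exists>f\<in>T. f i \<noteq> f j" unfolding B_def by auto
  ultimately have "\<exists>u\<in>T. u i = 1 \<and> (\<forall>j\<in>B. u j = 0)"
  proof (induction B rule: finite_induct)
    case empty
    then show ?case using one i by auto
  next
    case (insert k B)
    then obtain u where u: "u \<in> T" "u i = 1" "\<forall>j\<in>B. u j = 0" by auto
    obtain f where f: "f \<in> T" "f i \<noteq> f k" using insert.prems by auto
    obtain e where e: "e \<in> T" "\<forall>j\<in>I. e j = 1" using one by blast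
    obtain e' where e': "e' \<in> T" "\<forall>j\<in>I. e' j = - f k" using scale[OF e(1), of "- f k"] e(2) by auto
    obtain f' where f': "f' \<in> T" "\<forall>j\<in>I. f' j = f j - f k" using add[OF f(1) e'(1)] e'(2) by auto
    obtain v where v: "v \<in> T" "\<forall>j\<in>I. v j = (f j - f k) / (f i - f k)"
      using scale[OF f'(1), of "1 / (f i - f k)"] f'(2) by auto
    obtain w where w: "w \<in> T" "\<forall>j\<in>I. w j = u j * v j" using mult[OF u(1) v(1)] by blast
    have "w i = 1" using w v u f i by auto
    moreover have "\<forall>j\<in>insert k B. w j = 0" using w v u insert.prems by auto
    ultimately show ?case using w(1) by blast
  qed
  then obtain u where u: "u \<in> T" "u i = 1" "\<forall>j\<in>B. u j = 0" by blast
  have "\<forall>j\<in>I. u j = (if \<forall>f\<in>T. f i = f j then 1 else 0)"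
    using u unfolding B_def by auto
  then show ?thesis using u(1) by blast
qed

section \<open>Characters acting by convolution\<close>

locale finite_group = group +
  assumes finite_carrier [simp]: "finite (carrier G)"
begin

lemma carrier_neq_empty [simp]: "carrier G \<noteq> {}"
  using one_closed by blast

lemma card_carrier_neq_0: "of_nat (card (carrier G)) \<noteq> (0 :: complex)"
  using one_closed by (auto simp: card_eq_0_iff)

lemma sum_carrier_inv: "(\<Sum>x\<in>carrier G. f (inv x)) = (\<Sum>x\<in>carrier G. f x)"
  by (rule sum.reindex_bij_witness[of _ "\<lambda>x. inv x" "\<lambda>x. inv x"]) auto

lemma sum_carrier_lmult:
  assumes "a \<in> carrier G"
  shows "(\<Sum>x\<in>carrier G. f (a \<otimes> x)) = (\<Sum>x\<in>carrier G. f x)"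
  using assms
  by (intro sum.reindex_bij_witness[of _ "\<lambda>x. inv a \<otimes> x" "\<lambda>x. a \<otimes> x"])
    (auto simp: m_assoc[symmetric])

lemma sum_carrier_rmult:
  assumes "a \<in> carrier G"
  shows "(\<Sum>x\<in>carrier G. f (x \<otimes> a)) = (\<Sum>x\<in>carrier G. f x)"
  using assms
  by (intro sum.reindex_bij_witness[of _ "\<lambda>x. x \<otimes> inv a" "\<lambda>x. x \<otimes> a"])
    (auto simp: m_assoc)

lemma class_functionsD:
  assumes "f \<in> class_functions G"
  shows "g \<notin> carrier G \<Longrightarrow> f g = 0"
    "g \<in> carrier G \<Longrightarrow> x \<in> carrier G \<Longrightarrow> f (x \<otimes> g \<otimes> inv x) = f g"
  using assms unfolding class_functions_def by auto

lemma class_function_swap: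
  assumes f: "f \<in> class_functions G" and xy: "x \<in> carrier G" "y \<in> carrier G"
  shows "f (x \<otimes> y) = f (y \<otimes> x)"
proof -
  have "f (x \<otimes> (y \<otimes> x) \<otimes> inv x) = f (y \<otimes> x)"
    using class_functionsD(2)[OF f, of "y \<otimes> x" x] xy by simp
  then show ?thesis using xy by (simp add: m_assoc)
qed

text \<open>This form, unlike the definition, displays convolution as the average of translates of \<open>h\<close> with
  weights \<open>f\<close>.\<close>
lemma convolution_at:
  assumes g: "g \<in> carrier G"
  shows "convolution G f h g = (\<Sum>y\<in>carrier G. f y * h (g \<otimes> inv y)) / of_nat (card (carrier G))"
proof -
  have "(\<Sum>x\<in>carrier G. f (x \<otimes> g) * h (inv x)) = (\<Sum>x\<in>carrier G. f (x \<otimes> g) * h (g \<otimes> inv (x \<otimes> g)))"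
    using g by (intro sum.cong) (auto simp: inv_mult_group m_assoc[symmetric])
  also have "\<dots> = (\<Sum>y\<in>carrier G. f y * h (g \<otimes> inv y))"
    using sum_carrier_rmult[OF g, of "\<lambda>y. f y * h (g \<otimes> inv y)"] by simp
  finally show ?thesis using g unfolding convolution_def by simp
qed

lemma convolution_commute:
  assumes h: "h \<in> class_functions G"
  shows "convolution G f h = convolution G h f"
proof
  fix g
  show "convolution G f h g = convolution G h f g"
  proof (cases "g \<in> carrier G")
    case True
    have "(\<Sum>y\<in>carrier G. f y * h (g \<otimes> inv y)) = (\<Sum>y\<in>carrier G. h (inv y \<otimes> g) * f (inv (inv y)))"
      using True class_function_swap[OF h] by (intro sum.cong) auto
    also have "\<dots> = (\<Sum>y\<in>carrier G. h (y \<otimes> g) * f (inv y))"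
      using sum_carrier_inv[of "\<lambda>y. h (y \<otimes> g) * f (inv y)"] by simp
    finally show ?thesis
      unfolding convolution_at[OF True, of f h] using True by (simp add: convolution_def)
  qed (simp add: convolution_def)
qed

lemma convolution_sum_left:
  "convolution G (\<lambda>x. \<Sum>i\<in>I. c i * f i x) h g = (\<Sum>i\<in>I. c i * convolution G (f i) h g)"
proof (cases "g \<in> carrier G")
  case True
  have "(\<Sum>y\<in>carrier G. (\<Sum>i\<in>I. c i * f i y) * h (g \<otimes> inv y))
    = (\<Sum>i\<in>I. c i * (\<Sum>y\<in>carrier G. f i y * h (g \<otimes> inv y)))"
    unfolding sum_distrib_right sum_distrib_left by (subst sum.swap) (simp add: mult.assoc)
  then show ?thesis using True by (simp add: convolution_at) (simp add: sum_divide_distrib[of _ I])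
qed (simp add: convolution_def)

lemma char_in_class_functions:
  assumes rep: "mat_rep G n \<rho>"
  shows "rep_char G n \<rho> \<in> class_functions G"
proof -
  have swap: "rep_char G n \<rho> (g \<otimes> h) = rep_char G n \<rho> (h \<otimes> g)"
    if "g \<in> carrier G" "h \<in> carrier G" for g h
  proof -
    have "(\<Sum>i<n. \<rho> (g \<otimes> h) $$ (i,i)) = (\<Sum>i<n. \<Sum>p<n. \<rho> g $$ (i,p) * \<rho> h $$ (p,i))"
      using that by (simp add: mat_rep_mult_entry[OF rep])
    also have "\<dots> = (\<Sum>i<n. \<Sum>p<n. \<rho> h $$ (i,p) * \<rho> g $$ (p,i))"
      by (subst sum.swap) (simp add: mult.commute)
    also have "\<dots> = (\<Sum>i<n. \<rho> (h \<otimes> g) $$ (i,i))"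
      using that by (simp add: mat_rep_mult_entry[OF rep])
    finally show ?thesis using that by (simp add: rep_char_def)
  qed
  show ?thesis unfolding class_functions_def
  proof (intro CollectI conjI allI impI ballI)
    fix g x assume gx: "g \<in> carrier G" "x \<in> carrier G"
    then have "rep_char G n \<rho> (x \<otimes> g \<otimes> inv x) = rep_char G n \<rho> (inv x \<otimes> (x \<otimes> g))"
      using swap[of "x \<otimes> g" "inv x"] by simp
    then show "rep_char G n \<rho> (x \<otimes> g \<otimes> inv x) = rep_char G n \<rho> g"
      using gx by (simp add: m_assoc[symmetric])
  qed (simp add: rep_char_def)
qed

lemma rep_char_one:
  assumes "mat_rep G n \<rho>"
  shows "rep_char G n \<rho> \<one> = of_nat n"
  using mat_repD(2)[OF assms] by (simp add: rep_char_def)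

text \<open>The action of \<open>f\<close> in the representation \<open>\<rho>\<close>. The inverse is chosen so that
  convolution of \<open>f\<close> with the character of \<open>\<rho>\<close> is the trace of \<open>\<rho> g\<close> times this matrix, up to the factor \<open>|G|\<close>.\<close>
definition rep_sum :: "nat \<Rightarrow> ('a \<Rightarrow> complex mat) \<Rightarrow> ('a \<Rightarrow> complex) \<Rightarrow> complex mat" where
  "rep_sum n \<rho> f = mat n n (\<lambda>(i,j). \<Sum>g\<in>carrier G. f g * \<rho> (inv g) $$ (i,j))"

lemma rep_sum_carrier [simp]: "rep_sum n \<rho> f \<in> carrier_mat n n"
  "dim_row (rep_sum n \<rho> f) = n" "dim_col (rep_sum n \<rho> f) = n"
  unfolding rep_sum_def by auto

lemma rep_sum_commute:
  assumes rep: "mat_rep G n \<rho>" and f: "f \<in> class_functions G" and h: "h \<in> carrier G"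
  shows "\<rho> h * rep_sum n \<rho> f = rep_sum n \<rho> f * \<rho> h"
proof (rule eq_matI)
  note \<rho>h = mat_repD(1)[OF rep h]
  fix i l assume "i < dim_row (rep_sum n \<rho> f * \<rho> h)" "l < dim_col (rep_sum n \<rho> f * \<rho> h)"
  then have il: "i < n" "l < n" using \<rho>h by auto
  have "(\<rho> h * rep_sum n \<rho> f) $$ (i,l)
      = (\<Sum>p<n. \<rho> h $$ (i,p) * (\<Sum>g\<in>carrier G. f g * \<rho> (inv g) $$ (p,l)))"
    using il \<rho>h by (subst mult_mat_entry[of _ n n _ n]) (auto simp: rep_sum_def)
  also have "\<dots> = (\<Sum>g\<in>carrier G. f g * (\<Sum>p<n. \<rho> h $$ (i,p) * \<rho> (inv g) $$ (p,l)))"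
    unfolding sum_distrib_left by (subst sum.swap) (simp add: mult_ac)
  also have "\<dots> = (\<Sum>g\<in>carrier G. f g * \<rho> (h \<otimes> inv g) $$ (i,l))"
    using il h by (intro sum.cong) (auto simp: mat_rep_mult_entry[OF rep])
  \<comment> \<open>Replace \<open>g\<close> by its conjugate under \<open>h\<close>, where the class function \<open>f\<close> has the same value.\<close>
  also have "\<dots> = (\<Sum>g\<in>carrier G. f (h \<otimes> g \<otimes> inv h) * \<rho> (inv (h \<otimes> g \<otimes> inv h) \<otimes> h) $$ (i,l))"
    using h class_functionsD(2)[OF f] by (intro sum.cong) (auto simp: inv_mult_group m_assoc)
  also have "\<dots> = (\<Sum>g\<in>carrier G. f (h \<otimes> g) * \<rho> (inv (h \<otimes> g) \<otimes> h) $$ (i,l))"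
    using h sum_carrier_rmult[of "inv h" "\<lambda>g. f (h \<otimes> g) * \<rho> (inv (h \<otimes> g) \<otimes> h) $$ (i,l)"]
    by (simp add: m_assoc cong: sum.cong)
  also have "\<dots> = (\<Sum>g\<in>carrier G. f g * \<rho> (inv g \<otimes> h) $$ (i,l))"
    by (rule sum_carrier_lmult[OF h])
  also have "\<dots> = (\<Sum>g\<in>carrier G. f g * (\<Sum>p<n. \<rho> (inv g) $$ (i,p) * \<rho> h $$ (p,l)))"
    using il h by (intro sum.cong) (auto simp: mat_rep_mult_entry[OF rep])
  also have "\<dots> = (\<Sum>p<n. (\<Sum>g\<in>carrier G. f g * \<rho> (inv g) $$ (i,p)) * \<rho> h $$ (p,l))"
    unfolding sum_distrib_left sum_distrib_right by (subst sum.swap) (simp add: mult_ac)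
  also have "\<dots> = (rep_sum n \<rho> f * \<rho> h) $$ (i,l)"
    using il \<rho>h by (subst mult_mat_entry[of _ n n _ n]) (auto simp: rep_sum_def)
  finally show "(\<rho> h * rep_sum n \<rho> f) $$ (i,l) = (rep_sum n \<rho> f * \<rho> h) $$ (i,l)" .
qed (use mat_repD(1)[OF rep h] in auto)

text \<open>By Schur's lemma \<open>f\<close> acts on an irreducible representation as a scalar; taking the trace against
  \<open>\<rho> g\<close> turns this into the statement that the character is an eigenvector of convolution by \<open>f\<close>.\<close>
lemma class_function_acts_scalar:
  assumes irr: "irreducible_rep G n \<rho>" and f: "f \<in> class_functions G"
  obtains c where "rep_sum n \<rho> f = (c * of_nat (card (carrier G))) \<cdot>\<^sub>m 1\<^sub>m n"
    "\<And>g. convolution G f (rep_char G n \<rho>) g = c * rep_char G n \<rho> g"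
proof -
  note rep = irreducible_repD(1)[OF irr]
  obtain d where d: "rep_sum n \<rho> f = d \<cdot>\<^sub>m 1\<^sub>m n"
    using schur_scalar[OF irr rep_sum_carrier(1) rep_sum_commute[OF rep f]] by blast
  have "convolution G f (rep_char G n \<rho>) g = d / of_nat (card (carrier G)) * rep_char G n \<rho> g" for g
  proof (cases "g \<in> carrier G")
    case True
    have "(\<Sum>y\<in>carrier G. f y * rep_char G n \<rho> (g \<otimes> inv y))
        = (\<Sum>y\<in>carrier G. f y * (\<Sum>i<n. \<Sum>p<n. \<rho> g $$ (i,p) * \<rho> (inv y) $$ (p,i)))"
      using True by (intro sum.cong) (auto simp: rep_char_def mat_rep_mult_entry[OF rep])
    also have "\<dots> = (\<Sum>i<n. \<Sum>p<n. \<rho> g $$ (i,p) * (\<Sum>y\<in>carrier G. f y * \<rho> (inv y) $$ (p,i)))"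
      unfolding sum_distrib_left
      by (subst sum.swap, intro sum.cong refl, subst sum.swap) (simp add: mult_ac)
    also have "\<dots> = (\<Sum>i<n. \<Sum>p<n. \<rho> g $$ (i,p) * rep_sum n \<rho> f $$ (p,i))"
      by (intro sum.cong) (auto simp: rep_sum_def)
    also have "\<dots> = (\<Sum>i<n. \<Sum>p<n. if p = i then \<rho> g $$ (i,i) * d else 0)"
      unfolding d by (intro sum.cong) auto
    also have "\<dots> = d * rep_char G n \<rho> g"
      using True by (simp add: rep_char_def sum_distrib_left mult.commute)
    finally show ?thesis unfolding convolution_at[OF True] by simp
  qed (simp add: convolution_def rep_char_def)
  then show ?thesis using d that[of "d / of_nat (card (carrier G))"] by simp
qed

text \<open>Averaging the matrix unit at \<open>(j, k)\<close> over conjugation by \<open>\<rho>\<close> gives a scalar matrix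
  \<open>T (j, k)\<close> whose trace is \<open>|G|\<close> if \<open>j = k\<close>. The norm of the character is \<open>1/|G|\<close> times the sum of the
  entries \<open>(i, k)\<close> of \<open>T (i, k)\<close>, and only the \<open>n\<close> diagonal ones, each equal to \<open>|G|/n\<close>, are nonzero.\<close>
lemma irreducible_char_norm:
  assumes irr: "irreducible_rep G n \<rho>"
  shows "convolution G (rep_char G n \<rho>) (rep_char G n \<rho>) \<one> = 1"
proof -
  note rep = irreducible_repD(1)[OF irr]
  note n = irreducible_repD(2)[OF irr]
  define T where "T j = mat n n (\<lambda>(i,l). \<Sum>g\<in>carrier G. \<rho> g $$ (i, fst j) * \<rho> (inv g) $$ (snd j, l))" for j
  have T: "T j \<in> carrier_mat n n" for j unfolding T_def by simp
  have comm: "\<rho> h * T j = T j * \<rho> h" if h: "h \<in> carrier G" and j: "fst j < n" "snd j < n" for h j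
  proof (rule eq_matI)
    note \<rho>h = mat_repD(1)[OF rep h]
    fix i l assume "i < dim_row (T j * \<rho> h)" "l < dim_col (T j * \<rho> h)"
    then have il: "i < n" "l < n" using \<rho>h T[of j] by auto
    have "(\<rho> h * T j) $$ (i,l)
        = (\<Sum>p<n. \<rho> h $$ (i,p) * (\<Sum>g\<in>carrier G. \<rho> g $$ (p, fst j) * \<rho> (inv g) $$ (snd j, l)))"
      using il \<rho>h T by (subst mult_mat_entry[of _ n n _ n]) (auto simp: T_def)
    also have "\<dots> = (\<Sum>g\<in>carrier G. (\<Sum>p<n. \<rho> h $$ (i,p) * \<rho> g $$ (p, fst j)) * \<rho> (inv g) $$ (snd j, l))"
      unfolding sum_distrib_left sum_distrib_right by (subst sum.swap) (simp add: mult_ac)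
    also have "\<dots> = (\<Sum>g\<in>carrier G. \<rho> (h \<otimes> g) $$ (i, fst j) * \<rho> (inv (h \<otimes> g) \<otimes> h) $$ (snd j, l))"
      using il h j by (intro sum.cong) (auto simp: mat_rep_mult_entry[OF rep, symmetric] inv_mult_group m_assoc)
    also have "\<dots> = (\<Sum>g\<in>carrier G. \<rho> g $$ (i, fst j) * \<rho> (inv g \<otimes> h) $$ (snd j, l))"
      by (rule sum_carrier_lmult[OF h])
    also have "\<dots> = (\<Sum>g\<in>carrier G. \<rho> g $$ (i, fst j) * (\<Sum>p<n. \<rho> (inv g) $$ (snd j, p) * \<rho> h $$ (p,l)))"
      using il h j by (intro sum.cong) (auto simp: mat_rep_mult_entry[OF rep])
    also have "\<dots> = (\<Sum>p<n. (\<Sum>g\<in>carrier G. \<rho> g $$ (i, fst j) * \<rho> (inv g) $$ (snd j, p)) * \<rho> h $$ (p,l))"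
      unfolding sum_distrib_left sum_distrib_right by (subst sum.swap) (simp add: mult_ac)
    also have "\<dots> = (T j * \<rho> h) $$ (i,l)"
      using il \<rho>h T by (subst mult_mat_entry[of _ n n _ n]) (auto simp: T_def)
    finally show "(\<rho> h * T j) $$ (i,l) = (T j * \<rho> h) $$ (i,l)" .
  qed (use mat_repD(1)[OF rep h] T[of j] in auto)
  have "\<exists>c. T (j,k) = c \<cdot>\<^sub>m 1\<^sub>m n" if "j < n" "k < n" for j k
    using schur_scalar[OF irr T comm, of "(j,k)"] that by auto
  then obtain c where c: "\<And>j k. j < n \<Longrightarrow> k < n \<Longrightarrow> T (j,k) = c j k \<cdot>\<^sub>m 1\<^sub>m n" by metis
  have trace: "of_nat n * c j j = of_nat (card (carrier G))" if j: "j < n" for j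
  proof -
    have "of_nat n * c j j = (\<Sum>i<n. T (j,j) $$ (i,i))" using c[OF j j] by simp
    also have "\<dots> = (\<Sum>i<n. \<Sum>g\<in>carrier G. \<rho> (inv g) $$ (j,i) * \<rho> g $$ (i,j))"
      unfolding T_def by (intro sum.cong) (auto simp: mult.commute)
    also have "\<dots> = (\<Sum>g\<in>carrier G. \<rho> (inv g \<otimes> g) $$ (j,j))"
      using j by (subst sum.swap, intro sum.cong)
        (auto simp: mat_rep_mult_entry[OF rep, symmetric] simp del: l_inv)
    also have "\<dots> = of_nat (card (carrier G))" using j by (simp add: mat_repD(2)[OF rep])
    finally show ?thesis .
  qed
  have "(\<Sum>y\<in>carrier G. rep_char G n \<rho> y * rep_char G n \<rho> (\<one> \<otimes> inv y))
      = (\<Sum>y\<in>carrier G. \<Sum>i<n. \<Sum>k<n. \<rho> y $$ (i,i) * \<rho> (inv y) $$ (k,k))"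
    by (intro sum.cong) (auto simp: rep_char_def sum_product)
  also have "\<dots> = (\<Sum>i<n. \<Sum>k<n. \<Sum>y\<in>carrier G. \<rho> y $$ (i,i) * \<rho> (inv y) $$ (k,k))"
    by (subst sum.swap, intro sum.cong refl, subst sum.swap) simp
  also have "\<dots> = (\<Sum>i<n. \<Sum>k<n. T (i,k) $$ (i,k))"
    by (intro sum.cong) (auto simp: T_def)
  also have "\<dots> = (\<Sum>i<n. \<Sum>k<n. if k = i then c i i else 0)"
    by (intro sum.cong) (auto simp: c)
  also have "\<dots> = (\<Sum>i<n. of_nat (card (carrier G)) / of_nat n)"
    using trace n by (intro sum.cong) (auto simp: field_simps)
  also have "\<dots> = of_nat (card (carrier G))" using n by simp
  finally show ?thesis by (simp add: convolution_at)
qed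

end

section \<open>Completeness of the irreducible characters\<close>

context finite_group
begin

lemma rep_sum_intertwine:
  assumes F: "F \<in> carrier_mat m l" and R: "mat_rep G m R" and \<rho>: "mat_rep G l \<rho>"
    and int: "\<And>g. g \<in> carrier G \<Longrightarrow> R g * F = F * \<rho> g"
  shows "rep_sum m R f * F = F * rep_sum l \<rho> f"
proof (rule eq_matI)
  fix i j assume "i < dim_row (F * rep_sum l \<rho> f)" "j < dim_col (F * rep_sum l \<rho> f)"
  then have ij: "i < m" "j < l" using F by auto
  have "(rep_sum m R f * F) $$ (i,j) = (\<Sum>p<m. (\<Sum>g\<in>carrier G. f g * R (inv g) $$ (i,p)) * F $$ (p,j))"
    using ij F by (subst mult_mat_entry[of _ m m _ l]) (auto simp: rep_sum_def)
  also have "\<dots> = (\<Sum>g\<in>carrier G. f g * (\<Sum>p<m. R (inv g) $$ (i,p) * F $$ (p,j)))"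
    unfolding sum_distrib_left sum_distrib_right by (subst sum.swap) (simp add: mult_ac)
  also have "\<dots> = (\<Sum>g\<in>carrier G. f g * (R (inv g) * F) $$ (i,j))"
    using ij F mat_repD(1)[OF R] by (intro sum.cong) (auto simp: mult_mat_entry[of _ m m _ l])
  also have "\<dots> = (\<Sum>g\<in>carrier G. f g * (F * \<rho> (inv g)) $$ (i,j))"
    using int by (intro sum.cong) auto
  also have "\<dots> = (\<Sum>g\<in>carrier G. f g * (\<Sum>p<l. F $$ (i,p) * \<rho> (inv g) $$ (p,j)))"
    using ij F mat_repD(1)[OF \<rho>] by (intro sum.cong) (auto simp: mult_mat_entry[of _ m l _ l])
  also have "\<dots> = (\<Sum>p<l. F $$ (i,p) * (\<Sum>g\<in>carrier G. f g * \<rho> (inv g) $$ (p,j)))"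
    unfolding sum_distrib_left by (subst sum.swap) (simp add: mult_ac)
  also have "\<dots> = (F * rep_sum l \<rho> f) $$ (i,j)"
    using ij F by (subst mult_mat_entry[of _ m l _ l]) (auto simp: rep_sum_def)
  finally show "(rep_sum m R f * F) $$ (i,j) = (F * rep_sum l \<rho> f) $$ (i,j)" .
qed (use F in auto)

text \<open>The regular representation in the basis of group elements, listed by \<open>e\<close>. The formula for the action
  of \<open>f\<close> shows that the action is faithful and that adjoints come from \<open>g \<mapsto> cnj (f (inv g))\<close>.\<close>
lemma regular_rep_exists:
  obtains m e R where "bij_betw e {..<m} (carrier G)" "mat_rep G m R"
    "\<And>f i j. i < m \<Longrightarrow> j < m \<Longrightarrow> rep_sum m R f $$ (i,j) = f (e j \<otimes> inv (e i))"
proof -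
  define m where "m = card (carrier G)"
  obtain e where e: "bij_betw e {..<m} (carrier G)"
    using ex_bij_betw_nat_finite[OF finite_carrier] unfolding m_def atLeast0LessThan by blast
  have ec: "i < m \<Longrightarrow> e i \<in> carrier G" for i using e by (auto simp: bij_betw_def)
  have einj: "i < m \<Longrightarrow> j < m \<Longrightarrow> e i = e j \<longleftrightarrow> i = j" for i j
    using e by (auto simp: bij_betw_def inj_on_def)
  define R :: "'a \<Rightarrow> complex mat" where
    "R g = mat m m (\<lambda>(i,j). if e i = g \<otimes> e j then 1 else 0)" for g
  have "mat_rep G m R" unfolding mat_rep_def
  proof (intro conjI ballI)
    show "R \<one> = 1\<^sub>m m" unfolding R_def by (intro eq_matI) (auto simp: ec einj)
  next
    fix g h assume gh: "g \<in> carrier G" "h \<in> carrier G"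
    show "R (g \<otimes> h) = R g * R h"
    proof (rule eq_matI)
      fix i j assume "i < dim_row (R g * R h)" "j < dim_col (R g * R h)"
      then have ij: "i < m" "j < m" unfolding R_def by auto
      have "(R g * R h) $$ (i,j) = (\<Sum>p<m. (if e i = g \<otimes> e p then 1 else 0) * (if e p = h \<otimes> e j then 1 else 0))"
        using ij by (subst mult_mat_entry[of _ m m _ m]) (auto simp: R_def)
      also have "\<dots> = (\<Sum>x\<in>carrier G. (if e i = g \<otimes> x then 1 else 0) * (if x = h \<otimes> e j then 1 else 0))"
        by (rule sum.reindex_bij_betw[OF e])
      also have "\<dots> = (\<Sum>x\<in>carrier G. if x = h \<otimes> e j then (if e i = g \<otimes> (h \<otimes> e j) then 1 else 0) else 0)"
        by (intro sum.cong) auto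
      also have "\<dots> = R (g \<otimes> h) $$ (i,j)"
        using ij gh ec by (simp add: R_def m_assoc)
      finally show "R (g \<otimes> h) $$ (i,j) = (R g * R h) $$ (i,j)" by simp
    qed (auto simp: R_def)
  qed (auto simp: R_def)
  moreover have "rep_sum m R f $$ (i,j) = f (e j \<otimes> inv (e i))" if ij: "i < m" "j < m" for f i j
  proof -
    have eq: "e i = inv g \<otimes> e j \<longleftrightarrow> g = e j \<otimes> inv (e i)" if g: "g \<in> carrier G" for g
      using ec[OF ij(1)] ec[OF ij(2)] g
      by (metis inv_closed inv_equality inv_inv inv_solve_left inv_solve_right m_closed)
    have "rep_sum m R f $$ (i,j) = (\<Sum>g\<in>carrier G. f g * R (inv g) $$ (i,j))"
      using ij by (simp add: rep_sum_def)
    also have "\<dots> = (\<Sum>g\<in>carrier G. if g = e j \<otimes> inv (e i) then f g else 0)"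
      using ij by (intro sum.cong refl) (simp add: R_def eq)
    finally show ?thesis using ec ij by simp
  qed
  ultimately show ?thesis using that e by blast
qed

text \<open>Let \<open>M\<close> be the action of \<open>f\<close> on the regular representation and \<open>M'\<close> its conjugate transpose,
  which is the action of another class function \<open>f'\<close>. The image of \<open>M'\<close> is therefore an invariant
  subspace, nonzero as \<open>f\<close> is nonzero, and \<open>M\<close> is injective on it. So \<open>f\<close> acts injectively on an
  irreducible subrepresentation of this image, and the scalar by which it acts is not zero.\<close>
lemma nonzero_class_function_has_coefficient:
  assumes f: "f \<in> class_functions G" and g0: "f g0 \<noteq> 0"
  obtains n \<rho> where "irreducible_rep G n \<rho>" "convolution G f (rep_char G n \<rho>) \<one> \<noteq> 0"
proof -
  have g0c: "g0 \<in> carrier G" using class_functionsD(1)[OF f] g0 by blast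
  obtain m e R where e: "bij_betw e {..<m} (carrier G)" and R: "mat_rep G m R"
    and entry: "\<And>f i j. i < m \<Longrightarrow> j < m \<Longrightarrow> rep_sum m R f $$ (i,j) = f (e j \<otimes> inv (e i))"
    using regular_rep_exists by metis
  have ec: "i < m \<Longrightarrow> e i \<in> carrier G" for i using e by (auto simp: bij_betw_def)
  define f' where "f' g = (if g \<in> carrier G then cnj (f (inv g)) else 0)" for g
  have f': "f' \<in> class_functions G"
    unfolding class_functions_def
  proof (intro CollectI conjI allI impI ballI)
    fix g x assume gx: "g \<in> carrier G" "x \<in> carrier G"
    then show "f' (x \<otimes> g \<otimes> inv x) = f' g"
      using class_functionsD(2)[OF f, of "inv g" x] by (simp add: f'_def inv_mult_group m_assoc)
  qed (simp add: f'_def)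
  define M where "M = rep_sum m R f"
  define M' where "M' = rep_sum m R f'"
  have M: "M \<in> carrier_mat m m" and M': "M' \<in> carrier_mat m m" unfolding M_def M'_def by auto
  have adj: "M' $$ (i,j) = cnj (M $$ (j,i))" if "i < m" "j < m" for i j
    using that ec unfolding M_def M'_def by (simp add: entry f'_def inv_mult_group)
  define W where "W = (\<lambda>w. M' *\<^sub>v w) ` carrier_vec m"
  have W: "VectorSpace.subspace class_ring W (module_vec TYPE(complex) m)"
    unfolding subspace_vec_iff W_def
  proof (intro conjI ballI allI)
    show "(\<lambda>w. M' *\<^sub>v w) ` carrier_vec m \<subseteq> carrier_vec m" using M' by auto
    show "0\<^sub>v m \<in> (\<lambda>w. M' *\<^sub>v w) ` carrier_vec m"
      using M' by (intro image_eqI[of _ _ "0\<^sub>v m"]) (auto intro!: eq_vecI)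
  next
    fix x y assume "x \<in> (\<lambda>w. M' *\<^sub>v w) ` carrier_vec m" "y \<in> (\<lambda>w. M' *\<^sub>v w) ` carrier_vec m"
    then obtain a b where "x = M' *\<^sub>v a" "y = M' *\<^sub>v b" "a \<in> carrier_vec m" "b \<in> carrier_vec m" by blast
    then show "x + y \<in> (\<lambda>w. M' *\<^sub>v w) ` carrier_vec m"
      using mult_add_distrib_mat_vec[OF M', of a b] by (intro image_eqI[of _ _ "a + b"]) auto
  next
    fix c x assume "x \<in> (\<lambda>w. M' *\<^sub>v w) ` carrier_vec m"
    then obtain a where "x = M' *\<^sub>v a" "a \<in> carrier_vec m" by blast
    then show "c \<cdot>\<^sub>v x \<in> (\<lambda>w. M' *\<^sub>v w) ` carrier_vec m"
      using mult_mat_vec[OF M', of a c] by (intro image_eqI[of _ _ "c \<cdot>\<^sub>v a"]) auto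
  qed
  have inv: "R g *\<^sub>v w \<in> W" if g: "g \<in> carrier G" and w: "w \<in> W" for g w
  proof -
    obtain a where a: "w = M' *\<^sub>v a" "a \<in> carrier_vec m" using w unfolding W_def by blast
    note Rg = mat_repD(1)[OF R g]
    have "R g *\<^sub>v w = M' *\<^sub>v (R g *\<^sub>v a)"
      using assoc_mult_mat_vec[OF Rg M' a(2)] assoc_mult_mat_vec[OF M' Rg a(2)]
        rep_sum_commute[OF R f' g] a(1) unfolding M'_def by simp
    then show ?thesis using Rg a(2) unfolding W_def by auto
  qed
  obtain k C \<tau> where C: "C \<in> carrier_mat m k" "injective_mat C"
    and WC: "W = (\<lambda>v. C *\<^sub>v v) ` carrier_vec k" and \<tau>: "mat_rep G k \<tau>"
    and intC: "\<And>g. g \<in> carrier G \<Longrightarrow> R g * C = C * \<tau> g"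
    by (rule invariant_subspace_subrep[OF is_group R W inv]) (assumption | rule that)+
  have "k \<noteq> 0"
  proof
    assume "k = 0"
    then have "C *\<^sub>v v = 0\<^sub>v m" if "v \<in> carrier_vec k" for v
      using C(1) that by (intro eq_vecI) (auto simp: scalar_prod_def)
    then have W0: "w \<in> W \<Longrightarrow> w = 0\<^sub>v m" for w using WC by auto
    \<comment> \<open>At these indices the entry of \<open>M\<close> is \<open>f g0\<close>.\<close>
    obtain i j where ij: "i < m" "j < m" "e i = inv g0" "e j = \<one>"
      using e g0c by (metis (no_types, lifting) bij_betw_def image_iff inv_closed lessThan_iff one_closed)
    have "M' *\<^sub>v unit_vec m i = 0\<^sub>v m" using W0 unfolding W_def by auto
    then have "(M' *\<^sub>v unit_vec m i) $ j = 0" using ij by simp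
    then have "M' $$ (j,i) = 0" using ij M' by simp
    then show False using adj[OF ij(2,1)] g0 g0c ij entry[OF ij(1,2), of f] by (simp add: M_def)
  qed
  then obtain l D \<rho> where D: "D \<in> carrier_mat k l" "injective_mat D"
    and irr: "irreducible_rep G l \<rho>" and intD: "\<And>g. g \<in> carrier G \<Longrightarrow> \<tau> g * D = D * \<rho> g"
    using exists_irreducible_subrep[OF is_group \<tau>] by blast
  note \<rho> = irreducible_repD[OF irr]
  have "convolution G f (rep_char G l \<rho>) \<one> \<noteq> 0"
  proof
    assume conv0: "convolution G f (rep_char G l \<rho>) \<one> = 0"
    obtain c where c: "rep_sum l \<rho> f = (c * of_nat (card (carrier G))) \<cdot>\<^sub>m 1\<^sub>m l"
      "\<And>g. convolution G f (rep_char G l \<rho>) g = c * rep_char G l \<rho> g"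
      using class_function_acts_scalar[OF irr f] by metis
    have "c = 0" using c(2)[of \<one>] conv0 \<rho> by (simp add: rep_char_one)
    then have zero: "rep_sum l \<rho> f *\<^sub>v v = 0\<^sub>v l" if "v \<in> carrier_vec l" for v
      using that unfolding c(1) by (intro eq_vecI) auto
    define v where "v = (unit_vec l 0 :: complex vec)"
    have v: "v \<in> carrier_vec l" unfolding v_def by simp
    have Dv: "D *\<^sub>v v \<in> carrier_vec k" using D v by simp
    obtain w where w: "w \<in> carrier_vec m" "C *\<^sub>v (D *\<^sub>v v) = M' *\<^sub>v w"
      using Dv WC unfolding W_def by (metis (no_types, lifting) image_iff)
    have "M *\<^sub>v (C *\<^sub>v (D *\<^sub>v v)) = (M * C) *\<^sub>v (D *\<^sub>v v)"
      using assoc_mult_mat_vec[OF M C(1) Dv] by simp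
    also have "M * C = C * rep_sum k \<tau> f" unfolding M_def by (rule rep_sum_intertwine[OF C(1) R \<tau> intC])
    also have "\<dots> *\<^sub>v (D *\<^sub>v v) = C *\<^sub>v ((rep_sum k \<tau> f * D) *\<^sub>v v)"
      using assoc_mult_mat_vec[OF C(1) rep_sum_carrier(1) Dv, of \<tau> f]
        assoc_mult_mat_vec[OF rep_sum_carrier(1) D(1) v, of \<tau> f] by simp
    also have "rep_sum k \<tau> f * D = D * rep_sum l \<rho> f"
      by (rule rep_sum_intertwine[OF D(1) \<tau> \<rho>(1) intD])
    also have "\<dots> *\<^sub>v v = D *\<^sub>v (rep_sum l \<rho> f *\<^sub>v v)"
      by (rule assoc_mult_mat_vec[OF D(1) rep_sum_carrier(1) v])
    also have "\<dots> = 0\<^sub>v k" unfolding zero[OF v] using D by (intro eq_vecI) auto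
    also have "C *\<^sub>v 0\<^sub>v k = 0\<^sub>v m" using C by (intro eq_vecI) auto
    finally have "M' *\<^sub>v w = 0\<^sub>v m"
      using conjugate_transpose_kernel[OF M M' adj w(1)] w(2) by simp
    then have "D *\<^sub>v v = 0\<^sub>v k" using injective_matD[OF C(2,1) Dv] w(2) by simp
    then have "v = 0\<^sub>v l" using injective_matD[OF D(2,1) v] by simp
    then have "v $ 0 = (0\<^sub>v l :: complex vec) $ 0" by simp
    then show False using \<rho>(2) unfolding v_def by simp
  qed
  then show ?thesis using that irr by blast
qed

end

section \<open>The expansion of class functions in irreducible characters\<close>

context finite_group
begin

lemma Irr_cases:
  assumes "\<xi> \<in> Irr G"
  obtains n \<rho> where "irreducible_rep G n \<rho>" "\<xi> = rep_char G n \<rho>"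
  using assms unfolding Irr_def by blast

lemma Irr_class_function: "\<xi> \<in> Irr G \<Longrightarrow> \<xi> \<in> class_functions G"
  by (metis Irr_cases char_in_class_functions irreducible_repD(1))

lemma Irr_degree:
  assumes "\<xi> \<in> Irr G"
  obtains n where "n > 0" "\<xi> \<one> = of_nat n"
  using assms by (metis Irr_cases irreducible_repD rep_char_one)

lemma Irr_degree_neq_0: "\<xi> \<in> Irr G \<Longrightarrow> \<xi> \<one> \<noteq> 0"
  by (metis Irr_degree of_nat_eq_0_iff not_gr_zero)

text \<open>The scalar by which convolution with \<open>f\<close> multiplies the irreducible character \<open>\<xi>\<close>. It is also the
  coefficient of \<open>\<xi> \<one> * \<xi>\<close> in the expansion of \<open>f\<close>.\<close>
definition char_coeff :: "('a \<Rightarrow> complex) \<Rightarrow> ('a \<Rightarrow> complex) \<Rightarrow> complex" where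
  "char_coeff f \<xi> = convolution G f \<xi> \<one> / \<xi> \<one>"

lemma convolution_Irr:
  assumes f: "f \<in> class_functions G" and \<xi>: "\<xi> \<in> Irr G"
  shows "convolution G f \<xi> g = char_coeff f \<xi> * \<xi> g"
proof -
  obtain n \<rho> where irr: "irreducible_rep G n \<rho>" and [simp]: "\<xi> = rep_char G n \<rho>"
    using \<xi> by (rule Irr_cases)
  obtain c where c: "\<And>g. convolution G f \<xi> g = c * \<xi> g"
    using class_function_acts_scalar[OF irr f] by auto
  have "char_coeff f \<xi> = c"
    unfolding char_coeff_def c using Irr_degree_neq_0[OF \<xi>] by simp
  then show ?thesis using c by simp
qed

lemma convolution_scale:
  "convolution G (\<lambda>x. c * f x) (\<lambda>x. d * h x) g = c * d * convolution G f h g"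
  by (simp add: convolution_def sum_distrib_left mult_ac)

text \<open>The convolution of \<open>\<xi>\<close> and \<open>\<eta>\<close> is a multiple of each of them by commutativity. If
  it is nonzero, the two are proportional, the factor is \<open>1\<close> or \<open>-1\<close> as both have norm \<open>1\<close>, and it is \<open>1\<close>
  as degrees are positive.\<close>
lemma char_coeff_Irr:
  assumes \<xi>: "\<xi> \<in> Irr G" and \<eta>: "\<eta> \<in> Irr G"
  shows "char_coeff \<xi> \<eta> = (if \<xi> = \<eta> then 1 / \<xi> \<one> else 0)"
proof -
  have norm: "convolution G \<zeta> \<zeta> \<one> = 1" if "\<zeta> \<in> Irr G" for \<zeta>
    using that by (metis Irr_cases irreducible_char_norm)
  have "\<xi> = \<eta>" if ne: "char_coeff \<xi> \<eta> \<noteq> 0"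
  proof -
    define c where "c = char_coeff \<eta> \<xi> / char_coeff \<xi> \<eta>"
    have \<eta>\<xi>: "\<eta> g = c * \<xi> g" for g
      using convolution_Irr[OF Irr_class_function[OF \<xi>] \<eta>, of g]
        convolution_Irr[OF Irr_class_function[OF \<eta>] \<xi>, of g]
        convolution_commute[OF Irr_class_function[OF \<eta>], of \<xi>] ne
      unfolding c_def by (simp add: field_simps)
    then have "\<eta> = (\<lambda>x. c * \<xi> x)" by auto
    then have "c * c = 1" using norm[OF \<eta>] norm[OF \<xi>] convolution_scale[of c \<xi> c \<xi> \<one>] by simp
    then have "c = 1 \<or> c = - 1" using square_eq_1_iff by blast
    moreover have "c \<noteq> - 1"
    proof
      assume c: "c = - 1"
      obtain n m where "n > 0" "m > 0" "\<xi> \<one> = of_nat n" "\<eta> \<one> = of_nat m"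
        using Irr_degree[OF \<xi>] Irr_degree[OF \<eta>] by metis
      then have "of_nat (m + n) = (0 :: complex)"
        using \<eta>\<xi>[of \<one>] c by (metis add.left_inverse mult_minus1 of_nat_add)
      then show False using \<open>n > 0\<close> by (simp del: of_nat_add)
    qed
    ultimately show ?thesis using \<eta>\<xi> by (auto simp: fun_eq_iff)
  qed
  moreover have "char_coeff \<xi> \<xi> = 1 / \<xi> \<one>" unfolding char_coeff_def norm[OF \<xi>] by simp
  ultimately show ?thesis by auto
qed

lemma char_coeff_sum:
  "char_coeff (\<lambda>x. \<Sum>i\<in>I. c i * f i x) \<eta> = (\<Sum>i\<in>I. c i * char_coeff (f i) \<eta>)"
  unfolding char_coeff_def convolution_sum_left by (simp add: sum_divide_distrib)

lemma char_coeff_scale: "char_coeff (\<lambda>x. c * f x) \<eta> = c * char_coeff f \<eta>"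
  using char_coeff_sum[of "\<lambda>_. c" "\<lambda>_. f" "{()}"] by simp

lemma char_coeff_add: "char_coeff (\<lambda>x. f x + h x) \<eta> = char_coeff f \<eta> + char_coeff h \<eta>"
  unfolding char_coeff_def convolution_def by (simp add: distrib_right sum.distrib add_divide_distrib)

lemma finite_Irr: "finite (Irr G)"
proof -
  have "finite (Irr G) \<and> card (Irr G) \<le> card (carrier G)"
  proof (rule biorthogonal_functions_card_le[where b = "\<lambda>j x. if x = j then 1 else 0"
        and \<phi> = "\<lambda>\<eta> f. char_coeff f \<eta>"])
    fix \<xi> assume \<xi>: "\<xi> \<in> Irr G"
    have "\<xi> x = (\<Sum>j\<in>carrier G. \<xi> j * (if x = j then 1 else 0))" for x
      using class_functionsD(1)[OF Irr_class_function[OF \<xi>], of x] by (simp add: if_distrib cong: if_cong)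
    then show "\<exists>c. \<xi> = (\<lambda>x. \<Sum>j\<in>carrier G. c j * (if x = j then 1 else 0))" by blast
  next
    fix \<xi> assume "\<xi> \<in> Irr G"
    then show "char_coeff \<xi> \<xi> \<noteq> 0" by (simp add: char_coeff_Irr Irr_degree_neq_0)
  qed (auto simp: char_coeff_sum char_coeff_Irr)
  then show ?thesis by blast
qed

lemma class_functions_sum:
  assumes "\<And>i. i \<in> I \<Longrightarrow> f i \<in> class_functions G"
  shows "(\<lambda>x. \<Sum>i\<in>I. c i * f i x) \<in> class_functions G"
  using assms unfolding class_functions_def by (auto intro!: sum.neutral sum.cong)

lemma char_coeff_char_sum:
  assumes A: "A \<subseteq> Irr G" and \<eta>: "\<eta> \<in> Irr G"
  shows "char_coeff (\<lambda>x. \<Sum>\<xi>\<in>A. c \<xi> * (\<xi> \<one> * \<xi> x)) \<eta> = (if \<eta> \<in> A then c \<eta> else 0)"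
proof -
  have "char_coeff (\<lambda>x. \<Sum>\<xi>\<in>A. c \<xi> * (\<xi> \<one> * \<xi> x)) \<eta> = (\<Sum>\<xi>\<in>A. c \<xi> * (\<xi> \<one> * char_coeff \<xi> \<eta>))"
    by (simp add: char_coeff_sum char_coeff_scale)
  also have "\<dots> = (\<Sum>\<xi>\<in>A. if \<xi> = \<eta> then c \<eta> else 0)"
    using A \<eta> by (intro sum.cong) (auto simp: char_coeff_Irr Irr_degree_neq_0)
  also have "\<dots> = (if \<eta> \<in> A then c \<eta> else 0)"
    using finite_subset[OF A finite_Irr] by simp
  finally show ?thesis .
qed

text \<open>All coefficients of the difference of the two sides vanish by orthogonality, so the difference is zero.\<close>
lemma char_expansion:
  assumes f: "f \<in> class_functions G"
  shows "f g = (\<Sum>\<xi>\<in>Irr G. char_coeff f \<xi> * (\<xi> \<one> * \<xi> g))"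
proof -
  define h where "h g = (\<Sum>\<xi>\<in>Irr G. char_coeff f \<xi> * (\<xi> \<one> * \<xi> g))" for g
  define d where "d g = f g + (- 1) * h g" for g
  have "(\<lambda>g. \<Sum>\<xi>\<in>Irr G. (char_coeff f \<xi> * \<xi> \<one>) * \<xi> g) \<in> class_functions G"
    by (rule class_functions_sum) (rule Irr_class_function)
  then have "h \<in> class_functions G" unfolding h_def by (simp add: mult.assoc)
  then have d: "d \<in> class_functions G" using f unfolding d_def class_functions_def by auto
  have "d g = 0" for g
  proof (rule ccontr)
    assume "d g \<noteq> 0"
    then obtain n \<rho> where irr: "irreducible_rep G n \<rho>" and ne: "convolution G d (rep_char G n \<rho>) \<one> \<noteq> 0"
      using nonzero_class_function_has_coefficient[OF d] by blast
    define \<eta> where "\<eta> = rep_char G n \<rho>"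
    have \<eta>: "\<eta> \<in> Irr G" using irr unfolding Irr_def \<eta>_def by blast
    have "char_coeff d \<eta> = char_coeff f \<eta> + (- 1) * char_coeff h \<eta>"
      unfolding d_def char_coeff_add char_coeff_scale by simp
    also have "char_coeff h \<eta> = char_coeff f \<eta>"
      unfolding h_def using char_coeff_char_sum[OF subset_refl \<eta>] \<eta> by simp
    finally show False using ne Irr_degree_neq_0[OF \<eta>] unfolding char_coeff_def \<eta>_def by simp
  qed
  then show ?thesis unfolding d_def h_def by simp
qed

text \<open>Together with \<open>char_expansion\<close> this identifies the class functions under convolution with the
  algebra of all complex functions on the set of irreducible characters.\<close>
lemma char_coeff_convolution:
  assumes f: "f \<in> class_functions G" and h: "h \<in> class_functions G" and \<eta>: "\<eta> \<in> Irr G"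
  shows "char_coeff (convolution G f h) \<eta> = char_coeff f \<eta> * char_coeff h \<eta>"
proof -
  have fe: "f = (\<lambda>g. \<Sum>\<xi>\<in>Irr G. (char_coeff f \<xi> * \<xi> \<one>) * \<xi> g)"
    by (rule ext) (simp only: mult.assoc char_expansion[OF f, symmetric])
  have fh: "convolution G f h = (\<lambda>g. \<Sum>\<xi>\<in>Irr G. char_coeff f \<xi> * char_coeff h \<xi> * (\<xi> \<one> * \<xi> g))"
  proof
    fix g
    have "convolution G f h g = (\<Sum>\<xi>\<in>Irr G. (char_coeff f \<xi> * \<xi> \<one>) * convolution G \<xi> h g)"
      by (subst fe) (rule convolution_sum_left)
    also have "\<dots> = (\<Sum>\<xi>\<in>Irr G. char_coeff f \<xi> * char_coeff h \<xi> * (\<xi> \<one> * \<xi> g))"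
      using convolution_commute[OF h] convolution_Irr[OF h] by (intro sum.cong) (auto simp: mult_ac)
    finally show "convolution G f h g = \<dots>" .
  qed
  show ?thesis
    unfolding fh
    using char_coeff_char_sum[OF subset_refl \<eta>, of "\<lambda>\<xi>. char_coeff f \<xi> * char_coeff h \<xi>"] \<eta>
    by simp
qed

lemma char_coeff_convolution_unit:
  assumes \<eta>: "\<eta> \<in> Irr G"
  shows "char_coeff (\<lambda>g. if g = \<one> then of_nat (card (carrier G)) else 0) \<eta> = 1"
proof -
  have "(\<Sum>y\<in>carrier G. (if y = \<one> then of_nat (card (carrier G)) else 0) * \<eta> (\<one> \<otimes> inv y))
      = (\<Sum>y\<in>carrier G. if y = \<one> then of_nat (card (carrier G)) * \<eta> \<one> else 0)"
    by (intro sum.cong) auto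
  then show ?thesis
    using Irr_degree_neq_0[OF \<eta>] by (simp add: char_coeff_def convolution_at)
qed

lemma char_coeff_sigma_char:
  assumes "A \<subseteq> Irr G" "\<eta> \<in> Irr G"
  shows "char_coeff (sigma_char G A) \<eta> = (if \<eta> \<in> A then 1 else 0)"
  using char_coeff_char_sum[OF assms, of "\<lambda>_. 1"] unfolding sigma_char_def by simp

end

section \<open>The character partition of a supercharacter theory\<close>

lemma superclasses_image:
  "superclasses G S = (\<lambda>x. {h \<in> carrier G. \<forall>f\<in>S. f x = f h}) ` carrier G"
  unfolding superclasses_def quotient_def by auto

lemma superclassE:
  assumes "K \<in> superclasses G S" "x \<in> K"
  shows "x \<in> carrier G" "K = {h \<in> carrier G. \<forall>f\<in>S. f x = f h}"
  using assms unfolding superclasses_image by (auto, metis)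

lemma superclass_of:
  assumes "x \<in> carrier G"
  obtains K where "K \<in> superclasses G S" "x \<in> K"
  using assms unfolding superclasses_image by blast

lemma superclasses_disjoint:
  assumes "K \<in> superclasses G S" "L \<in> superclasses G S" "x \<in> K" "x \<in> L"
  shows "K = L"
  using superclassE(2)[OF assms(1,3)] superclassE(2)[OF assms(2,4)] by simp

locale supercharacter_group = finite_group +
  fixes S :: "('a \<Rightarrow> complex) set"
  assumes supercharacter_theory: "supercharacter_theory G S"
begin

lemma theory_class_function: "f \<in> S \<Longrightarrow> f \<in> class_functions G"
  using supercharacter_theory unfolding supercharacter_theory_def by blast

lemma theory_closed:
  "f \<in> S \<Longrightarrow> h \<in> S \<Longrightarrow> (\<lambda>g. f g + h g) \<in> S"
  "f \<in> S \<Longrightarrow> (\<lambda>g. c * f g) \<in> S"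
  "f \<in> S \<Longrightarrow> h \<in> S \<Longrightarrow> (\<lambda>g. f g * h g) \<in> S"
  "f \<in> S \<Longrightarrow> h \<in> S \<Longrightarrow> convolution G f h \<in> S"
  using supercharacter_theory unfolding supercharacter_theory_def by auto

lemma theory_units:
  "(\<lambda>g. if g \<in> carrier G then 1 else 0) \<in> S"
  "(\<lambda>g. if g = \<one> then of_nat (card (carrier G)) else 0) \<in> S"
  using supercharacter_theory unfolding supercharacter_theory_def by auto

lemma theory_sum:
  assumes "\<And>i. i \<in> I \<Longrightarrow> f i \<in> S"
  shows "(\<lambda>g. \<Sum>i\<in>I. c i * f i g) \<in> S"
  using assms
proof (induction I rule: infinite_finite_induct)
  case (insert i I)
  then show ?case using theory_closed(1)[of "\<lambda>g. c i * f i g"] theory_closed(2) by simp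
qed (use theory_closed(2)[OF theory_units(1), of 0] in auto)

lemma finite_superclasses: "finite (superclasses G S)"
  unfolding superclasses_image by simp

text \<open>The superclasses are the joint level sets of the pointwise algebra \<open>S\<close>.\<close>
lemma superclass_indicator:
  assumes K: "K \<in> superclasses G S"
  shows "(\<lambda>g. if g \<in> K then 1 else 0) \<in> S"
proof -
  obtain x where x: "x \<in> carrier G" "K = {h \<in> carrier G. \<forall>f\<in>S. f x = f h}"
    using K unfolding superclasses_image by blast
  have "\<exists>u\<in>S. \<forall>j\<in>carrier G. u j = (if \<forall>f\<in>S. f x = f j then 1 else 0)"
  proof (rule algebra_separates_points[OF finite_carrier x(1)])
    show "\<exists>u\<in>S. \<forall>j\<in>carrier G. u j = 1" using theory_units(1) by (rule bexI[rotated]) simp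
  next
    fix f h assume fh: "f \<in> S" "h \<in> S"
    show "\<exists>u\<in>S. \<forall>j\<in>carrier G. u j = f j + h j"
      using theory_closed(1)[OF fh] by (rule bexI[rotated]) simp
    show "\<exists>u\<in>S. \<forall>j\<in>carrier G. u j = f j * h j"
      using theory_closed(3)[OF fh] by (rule bexI[rotated]) simp
  next
    fix f c assume f: "f \<in> S"
    show "\<exists>u\<in>S. \<forall>j\<in>carrier G. u j = c * f j"
      using theory_closed(2)[OF f, of c] by (rule bexI[rotated]) simp
  qed
  then obtain u where u: "u \<in> S" "\<And>j. j \<in> carrier G \<Longrightarrow> u j = (if \<forall>f\<in>S. f x = f j then 1 else 0)"
    by blast
  have "u g = (if g \<in> K then 1 else 0)" for g
    using u(2)[of g] class_functionsD(1)[OF theory_class_function[OF u(1)], of g] x(2)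
    by (cases "g \<in> carrier G") auto
  then have "u = (\<lambda>g. if g \<in> K then 1 else 0)" by auto
  then show ?thesis using u(1) by simp
qed

lemma superclass_expansion:
  assumes off: "\<And>g. g \<notin> carrier G \<Longrightarrow> f g = (0 :: complex)"
    and const: "\<And>K g h. K \<in> superclasses G S \<Longrightarrow> g \<in> K \<Longrightarrow> h \<in> K \<Longrightarrow> f g = f h"
  shows "f = (\<lambda>g. \<Sum>K\<in>superclasses G S. f (SOME x. x \<in> K) * (if g \<in> K then 1 else 0))"
proof
  fix g
  show "f g = (\<Sum>K\<in>superclasses G S. f (SOME x. x \<in> K) * (if g \<in> K then 1 else 0))"
  proof (cases "g \<in> carrier G")
    case True
    then obtain L where L: "L \<in> superclasses G S" "g \<in> L" by (rule superclass_of)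
    have iff: "g \<in> K \<longleftrightarrow> K = L" if "K \<in> superclasses G S" for K
      using superclasses_disjoint[OF that L(1) _ L(2)] L(2) by blast
    have "(\<Sum>K\<in>superclasses G S. f (SOME x. x \<in> K) * (if g \<in> K then 1 else 0))
        = (\<Sum>K\<in>superclasses G S. if K = L then f (SOME x. x \<in> L) else 0)"
      by (intro sum.cong refl) (simp add: iff)
    also have "\<dots> = f (SOME x. x \<in> L)" using L finite_superclasses by simp
    also have "\<dots> = f g" using const[OF L(1) someI[of "\<lambda>x. x \<in> L", OF L(2)] L(2)] .
    finally show ?thesis by simp
  next
    case False
    then have "g \<notin> K" if "K \<in> superclasses G S" for K using superclassE(1)[OF that] by blast
    then show ?thesis using off[OF False] by simp
  qed
qed

lemma constant_on_superclasses_in_theory: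
  assumes "\<And>g. g \<notin> carrier G \<Longrightarrow> f g = (0 :: complex)"
    and "\<And>K g h. K \<in> superclasses G S \<Longrightarrow> g \<in> K \<Longrightarrow> h \<in> K \<Longrightarrow> f g = f h"
  shows "f \<in> S"
proof -
  define h where "h = (\<lambda>g. \<Sum>K\<in>superclasses G S. f (SOME x. x \<in> K) * (if g \<in> K then 1 else 0))"
  have "f = h" unfolding h_def by (rule superclass_expansion[of f]) (fact assms)+
  moreover have "h \<in> S" unfolding h_def
    by (rule theory_sum[of _ "\<lambda>K g. if g \<in> K then 1 else 0" "\<lambda>K. f (SOME x. x \<in> K)"])
      (rule superclass_indicator)
  ultimately show ?thesis by simp
qed

lemma theory_constant_on_superclass:
  assumes "K \<in> superclasses G S" "f \<in> S" "g \<in> K" "h \<in> K"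
  shows "f g = f h"
  using superclassE(2)[OF assms(1,3)] assms by auto

lemma theory_superclass_expansion:
  assumes "f \<in> S"
  shows "f = (\<lambda>g. \<Sum>K\<in>superclasses G S. f (SOME x. x \<in> K) * (if g \<in> K then 1 else 0))"
proof (rule superclass_expansion[of f])
  show "f g = 0" if "g \<notin> carrier G" for g
    using class_functionsD(1)[OF theory_class_function[OF assms] that] .
  show "f g = f h" if "K \<in> superclasses G S" "g \<in> K" "h \<in> K" for K g h
    using theory_constant_on_superclass[OF that(1) assms that(2,3)] .
qed

text \<open>The coefficient functions of the members of \<open>S\<close> form a unital algebra of functions on the
  irreducible characters. The indicator of a level set of this algebra is the coefficient function of some
  member of \<open>S\<close>, and that member is the sum \<open>\<sigma>\<close> over the level set.\<close>
lemma sigma_char_in_theory: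
  assumes \<xi>: "\<xi> \<in> Irr G"
  shows "sigma_char G {\<eta> \<in> Irr G. \<forall>f\<in>S. char_coeff f \<xi> = char_coeff f \<eta>} \<in> S"
proof -
  have "\<exists>u\<in>char_coeff ` S. \<forall>\<eta>\<in>Irr G. u \<eta> = (if \<forall>t\<in>char_coeff ` S. t \<xi> = t \<eta> then 1 else 0)"
  proof (rule algebra_separates_points[OF finite_Irr \<xi>])
    show "\<exists>u\<in>char_coeff ` S. \<forall>\<eta>\<in>Irr G. u \<eta> = 1"
      using theory_units(2) char_coeff_convolution_unit by blast
  next
    fix a b assume "a \<in> char_coeff ` S" "b \<in> char_coeff ` S"
    then obtain f h where fh: "f \<in> S" "h \<in> S" "a = char_coeff f" "b = char_coeff h" by blast
    show "\<exists>u\<in>char_coeff ` S. \<forall>\<eta>\<in>Irr G. u \<eta> = a \<eta> + b \<eta>"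
      using theory_closed(1)[OF fh(1,2)] char_coeff_add fh by blast
    show "\<exists>u\<in>char_coeff ` S. \<forall>\<eta>\<in>Irr G. u \<eta> = a \<eta> * b \<eta>"
      using theory_closed(4)[OF fh(1,2)] fh
        char_coeff_convolution[OF theory_class_function theory_class_function] by blast
  next
    fix a c assume "a \<in> char_coeff ` S"
    then obtain f where f: "f \<in> S" "a = char_coeff f" by blast
    show "\<exists>u\<in>char_coeff ` S. \<forall>\<eta>\<in>Irr G. u \<eta> = c * a \<eta>"
      using theory_closed(2)[OF f(1)] char_coeff_scale f(2) by blast
  qed
  then obtain f where f: "f \<in> S"
    and coeff: "\<And>\<eta>. \<eta> \<in> Irr G \<Longrightarrow> char_coeff f \<eta> = (if \<forall>t\<in>S. char_coeff t \<xi> = char_coeff t \<eta> then 1 else 0)"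
    by auto
  have "f g = sigma_char G {\<eta> \<in> Irr G. \<forall>f\<in>S. char_coeff f \<xi> = char_coeff f \<eta>} g" for g
  proof -
    have "f g = (\<Sum>\<eta>\<in>Irr G. char_coeff f \<eta> * (\<eta> \<one> * \<eta> g))"
      by (rule char_expansion[OF theory_class_function[OF f]])
    also have "\<dots> = (\<Sum>\<eta>\<in>Irr G. if \<forall>t\<in>S. char_coeff t \<xi> = char_coeff t \<eta> then \<eta> \<one> * \<eta> g else 0)"
      by (intro sum.cong) (auto simp: coeff)
    also have "\<dots> = sigma_char G {\<eta> \<in> Irr G. \<forall>f\<in>S. char_coeff f \<xi> = char_coeff f \<eta>} g"
      unfolding sigma_char_def using finite_Irr by (subst sum.inter_filter) auto
    finally show ?thesis .
  qed
  then have "f = sigma_char G {\<eta> \<in> Irr G. \<forall>f\<in>S. char_coeff f \<xi> = char_coeff f \<eta>}" by auto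
  then show ?thesis using f by simp
qed

text \<open>The blocks are the joint level sets of the coefficient functions. Both the \<open>\<sigma>\<close> over blocks
  and the indicators of superclasses span \<open>S\<close> and are linearly independent, the former
  by means of their coefficients and the latter by means of their values, so the two families have the same size.\<close>
theorem char_partition_exists: "\<exists>\<X>. is_char_partition G S \<X>"
proof -
  define blk where "blk \<xi> = {\<eta> \<in> Irr G. \<forall>f\<in>S. char_coeff f \<xi> = char_coeff f \<eta>}" for \<xi>
  define \<X> where "\<X> = blk ` Irr G"
  have blk_self: "\<xi> \<in> Irr G \<Longrightarrow> \<xi> \<in> blk \<xi>" for \<xi> unfolding blk_def by simp
  have blk_eq: "X = blk \<xi>" if "X \<in> \<X>" "\<xi> \<in> X" for X \<xi>
    using that unfolding \<X>_def blk_def by auto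
  have sub: "X \<subseteq> Irr G" if "X \<in> \<X>" for X using that unfolding \<X>_def blk_def by auto
  have fin: "finite \<X>" unfolding \<X>_def using finite_Irr by simp
  have part: "partition_on (Irr G) \<X>"
  proof (rule partition_onI)
    show "\<Union>\<X> = Irr G" using blk_self sub unfolding \<X>_def by blast
    show "disjnt X Y" if "X \<in> \<X>" "Y \<in> \<X>" "X \<noteq> Y" for X Y
      using that blk_eq unfolding disjnt_def by blast
    show "{} \<notin> \<X>" using blk_self unfolding \<X>_def by blast
  qed
  have sig: "sigma_char G X \<in> S" if "X \<in> \<X>" for X
    using that sigma_char_in_theory unfolding \<X>_def blk_def by blast
  have expand: "f = (\<lambda>g. \<Sum>X\<in>\<X>. char_coeff f (SOME \<xi>. \<xi> \<in> X) * sigma_char G X g)" if f: "f \<in> S" for f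
  proof
    fix g
    have "f g = (\<Sum>\<xi>\<in>\<Union>\<X>. char_coeff f \<xi> * (\<xi> \<one> * \<xi> g))"
      using char_expansion[OF theory_class_function[OF f]] partition_onD1[OF part] by simp
    also have "\<dots> = (\<Sum>X\<in>\<X>. \<Sum>\<xi>\<in>X. char_coeff f \<xi> * (\<xi> \<one> * \<xi> g))"
      using finite_subset[OF sub finite_Irr] blk_eq by (subst sum.Union_disjoint) (blast, blast, simp)
    also have "\<dots> = (\<Sum>X\<in>\<X>. char_coeff f (SOME \<xi>. \<xi> \<in> X) * sigma_char G X g)"
    proof (intro sum.cong refl)
      fix X assume X: "X \<in> \<X>"
      have "char_coeff f \<xi> = char_coeff f (SOME \<xi>. \<xi> \<in> X)" if "\<xi> \<in> X" for \<xi>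
      proof -
        have "(SOME \<xi>. \<xi> \<in> X) \<in> blk \<xi>" using someI[of "\<lambda>\<xi>. \<xi> \<in> X", OF that] blk_eq[OF X that] by simp
        then show ?thesis using f unfolding blk_def by blast
      qed
      then show "(\<Sum>\<xi>\<in>X. char_coeff f \<xi> * (\<xi> \<one> * \<xi> g)) = char_coeff f (SOME \<xi>. \<xi> \<in> X) * sigma_char G X g"
        unfolding sigma_char_def sum_distrib_left by (intro sum.cong) auto
    qed
    finally show "f g = (\<Sum>X\<in>\<X>. char_coeff f (SOME \<xi>. \<xi> \<in> X) * sigma_char G X g)" .
  qed
  define ind :: "'a set \<Rightarrow> 'a \<Rightarrow> complex" where "ind K = (\<lambda>g. if g \<in> K then 1 else 0)" for K
  have coeff: "char_coeff (sigma_char G Y) (SOME \<xi>. \<xi> \<in> X) = (if X = Y then 1 else 0)"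
    if XY: "X \<in> \<X>" "Y \<in> \<X>" for X Y
  proof -
    have "X \<noteq> {}" using partition_onD3[OF part] XY by blast
    then have s: "(SOME \<xi>. \<xi> \<in> X) \<in> X" by (simp add: some_in_eq)
    have mem: "(SOME \<xi>. \<xi> \<in> X) \<in> Y \<longleftrightarrow> X = Y" using s blk_eq[OF XY(1) s] blk_eq[OF XY(2)] by metis
    have "(SOME \<xi>. \<xi> \<in> X) \<in> Irr G" using s sub[OF XY(1)] by blast
    then show ?thesis by (simp only: char_coeff_sigma_char[OF sub[OF XY(2)]] mem)
  qed
  have inj_sigma: "inj_on (sigma_char G) \<X>"
  proof (rule inj_onI)
    fix X Y assume "X \<in> \<X>" "Y \<in> \<X>" "sigma_char G X = sigma_char G Y"
    then show "X = Y" using coeff[of X X] coeff[of X Y] by (cases "X = Y") simp_all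
  qed
  have inj_ind: "inj ind"
  proof (rule inj_onI, rule Set.set_eqI)
    fix K L x assume "ind K = ind L"
    from fun_cong[OF this, of x] show "x \<in> K \<longleftrightarrow> x \<in> L" by (auto simp: ind_def split: if_splits)
  qed
  have nonempty: "K \<noteq> {}" if "K \<in> superclasses G S" for K using that unfolding superclasses_image by auto
  have "finite (sigma_char G ` \<X>) \<and> card (sigma_char G ` \<X>) \<le> card (superclasses G S)"
  proof (rule biorthogonal_functions_card_le[where b = ind
        and \<phi> = "\<lambda>a f. char_coeff f (SOME \<xi>. \<xi> \<in> inv_into \<X> (sigma_char G) a)"])
    fix a assume "a \<in> sigma_char G ` \<X>"
    then have "a \<in> S" using sig by blast
    then show "\<exists>c. a = (\<lambda>x. \<Sum>K\<in>superclasses G S. c K * ind K x)"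
      unfolding ind_def
      by (intro exI[of _ "\<lambda>K. a (SOME x. x \<in> K)"]) (rule theory_superclass_expansion[of a])
  qed (auto simp: char_coeff_sum coeff inv_into_f_f[OF inj_sigma] finite_superclasses)
  then have le1: "card \<X> \<le> card (superclasses G S)" using card_image[OF inj_sigma] by simp
  have "finite (ind ` superclasses G S) \<and> card (ind ` superclasses G S) \<le> card \<X>"
  proof (rule biorthogonal_functions_card_le[where b = "sigma_char G"
        and \<phi> = "\<lambda>a f. f (SOME x. x \<in> inv_into UNIV ind a)", OF fin])
    fix a assume "a \<in> ind ` superclasses G S"
    then have "a \<in> S" using superclass_indicator unfolding ind_def by auto
    then show "\<exists>c. a = (\<lambda>x. \<Sum>X\<in>\<X>. c X * sigma_char G X x)"
      by (intro exI[of _ "\<lambda>X. char_coeff a (SOME \<xi>. \<xi> \<in> X)"]) (rule expand[of a])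
  next
    fix a assume "a \<in> ind ` superclasses G S"
    then obtain K where K: "a = ind K" "K \<in> superclasses G S" by blast
    have "inv_into UNIV ind a = K" unfolding K(1) by (rule inv_into_f_f[OF inj_ind UNIV_I])
    moreover have "(SOME x. x \<in> K) \<in> K" using nonempty[OF K(2)] by (simp add: some_in_eq)
    ultimately show "a (SOME x. x \<in> inv_into UNIV ind a) \<noteq> 0"
      by (simp only: K(1)) (simp add: ind_def)
  next
    fix a b assume "a \<in> ind ` superclasses G S" "b \<in> ind ` superclasses G S" "a \<noteq> b"
    then obtain K L where K: "a = ind K" "K \<in> superclasses G S" "b = ind L" "L \<in> superclasses G S"
      and ne: "K \<noteq> L" by blast
    have "(SOME x. x \<in> K) \<in> K" using nonempty[OF K(2)] by (simp add: some_in_eq)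
    then have "(SOME x. x \<in> K) \<notin> L" using superclasses_disjoint[OF K(2,4)] ne by blast
    moreover have "inv_into UNIV ind a = K" unfolding K(1) by (rule inv_into_f_f[OF inj_ind UNIV_I])
    ultimately show "b (SOME x. x \<in> inv_into UNIV ind a) = 0"
      unfolding K(3) by (simp only:) (simp add: ind_def)
  qed auto
  then have "card (superclasses G S) \<le> card \<X>"
    using card_image[OF inj_on_subset[OF inj_ind subset_UNIV]] by simp
  moreover have "S = {(\<lambda>g. \<Sum>X\<in>\<X>. c X * sigma_char G X g) | c. True}"
  proof (rule Set.set_eqI, rule iffI)
    fix f assume "f \<in> S"
    then show "f \<in> {(\<lambda>g. \<Sum>X\<in>\<X>. c X * sigma_char G X g) | c. True}"
      by (intro CollectI exI[of _ "\<lambda>X. char_coeff f (SOME \<xi>. \<xi> \<in> X)"] conjI TrueI) (rule expand[of f])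
  next
    fix f assume "f \<in> {(\<lambda>g. \<Sum>X\<in>\<X>. c X * sigma_char G X g) | c. True}"
    then obtain c where "f = (\<lambda>g. \<Sum>X\<in>\<X>. c X * sigma_char G X g)" by blast
    then show "f \<in> S" using theory_sum[of \<X> "sigma_char G" c] sig by simp
  qed
  ultimately have "is_char_partition G S \<X>"
    unfolding is_char_partition_def using part le1 theory_constant_on_superclass[OF _ sig]
    by (intro conjI ballI) (assumption | linarith | blast)+
  then show ?thesis by blast
qed

end

lemma theory_of_classesD:
  assumes "f \<in> theory_of_classes G \<K>"
  shows "g \<notin> carrier G \<Longrightarrow> f g = 0"
    "K \<in> \<K> \<Longrightarrow> g \<in> K \<Longrightarrow> h \<in> K \<Longrightarrow> f g = f h"
  using assms unfolding theory_of_classes_def by blast+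

context supercharacter_group
begin

lemma char_partition: "is_char_partition G S (char_partition G S)"
  unfolding char_partition_def using char_partition_exists by (rule someI_ex)

lemma char_partition_partition: "partition_on (Irr G) (char_partition G S)"
  using char_partition unfolding is_char_partition_def by blast

lemma char_partition_subset: "X \<in> char_partition G S \<Longrightarrow> X \<subseteq> Irr G"
  using partition_onD1[OF char_partition_partition] by blast

lemma finite_char_partition: "finite (char_partition G S)"
  using finite_elements[OF finite_Irr char_partition_partition] .

lemma theory_as_supercharacter_sum:
  assumes "f \<in> S"
  obtains c where "f = (\<lambda>g. \<Sum>X\<in>char_partition G S. c X * sigma_char G X g)"
  using assms char_partition unfolding is_char_partition_def by blast

lemma supercharacter_sum_in_theory:
  "(\<lambda>g. \<Sum>X\<in>char_partition G S. c X * sigma_char G X g) \<in> S"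
proof -
  have eq: "S = {(\<lambda>g. \<Sum>X\<in>char_partition G S. c X * sigma_char G X g) | c. True}"
    using char_partition unfolding is_char_partition_def by blast
  show ?thesis by (rule subsetD[OF equalityD2[OF eq]]) (intro CollectI exI[of _ c] conjI refl TrueI)
qed

lemma supercharacter_in_theory:
  assumes X: "X \<in> char_partition G S"
  shows "sigma_char G X \<in> S"
proof -
  have "sigma_char G X = (\<lambda>g. \<Sum>Y\<in>char_partition G S. (if Y = X then 1 else 0) * sigma_char G Y g)"
  proof
    fix g
    have "(\<Sum>Y\<in>char_partition G S. (if Y = X then 1 else 0) * sigma_char G Y g)
        = (\<Sum>Y\<in>char_partition G S. if Y = X then sigma_char G X g else 0)"
      by (intro sum.cong) auto
    then show "sigma_char G X g
        = (\<Sum>Y\<in>char_partition G S. (if Y = X then 1 else 0) * sigma_char G Y g)"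
      using X finite_char_partition by simp
  qed
  also have "\<dots> \<in> S"
    by (rule supercharacter_sum_in_theory)
  finally show ?thesis .
qed

text \<open>The value at \<open>\<one>\<close> is a nonempty sum of squares of positive degrees.\<close>
lemma supercharacter_degree_neq_0:
  assumes X: "X \<in> char_partition G S"
  shows "sigma_char G X \<one> \<noteq> 0"
proof -
  have sub: "X \<subseteq> Irr G" by (rule char_partition_subset[OF X])
  have "\<exists>n::nat. n > 0 \<and> \<xi> \<one> = of_nat n" if "\<xi> \<in> X" for \<xi>
    using Irr_degree[of \<xi>] sub that by blast
  then obtain d :: "_ \<Rightarrow> nat" where d: "\<And>\<xi>. \<xi> \<in> X \<Longrightarrow> d \<xi> > 0 \<and> \<xi> \<one> = of_nat (d \<xi>)" by metis
  have "sigma_char G X \<one> = of_nat (\<Sum>\<xi>\<in>X. d \<xi> * d \<xi>)"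
    unfolding sigma_char_def using d by (auto intro!: sum.cong)
  moreover obtain \<xi> where "\<xi> \<in> X" using partition_onD3[OF char_partition_partition] X by (metis ex_in_conv)
  then have "(\<Sum>\<xi>\<in>X. d \<xi> * d \<xi>) \<noteq> 0"
    using d finite_subset[OF sub finite_Irr] by auto
  ultimately show ?thesis by (metis of_nat_eq_0_iff)
qed

text \<open>The left-hand side is the regular character: the identity for convolution has all coefficients \<open>1\<close>.\<close>
lemma sum_supercharacters:
  "(\<Sum>X\<in>char_partition G S. sigma_char G X g) = (if g = \<one> then of_nat (card (carrier G)) else 0)"
proof -
  note P = char_partition_partition
  have "(if g = \<one> then of_nat (card (carrier G)) else 0) = (\<Sum>\<xi>\<in>Irr G. \<xi> \<one> * \<xi> g)"
    using char_expansion[OF theory_class_function[OF theory_units(2)], of g] char_coeff_convolution_unit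
    by (simp cong: sum.cong)
  also have "\<dots> = (\<Sum>\<xi>\<in>\<Union>(char_partition G S). \<xi> \<one> * \<xi> g)" using partition_onD1[OF P] by simp
  also have "\<dots> = (\<Sum>X\<in>char_partition G S. sigma_char G X g)"
    unfolding sigma_char_def
    using finite_subset[OF char_partition_subset finite_Irr] partition_onD2[OF P]
    by (subst sum.Union_disjoint) (auto simp: disjoint_def)
  finally show ?thesis by simp
qed

text \<open>A member of \<open>S\<close> is a combination of supercharacters, so its coefficients are constant on each block
  of the partition.\<close>
lemma theory_acts_on_supercharacter:
  assumes f: "f \<in> S" and X: "X \<in> char_partition G S"
  obtains c where "\<And>g. convolution G f (sigma_char G X) g = c * sigma_char G X g"
proof -
  have sub: "X \<subseteq> Irr G" by (rule char_partition_subset[OF X])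
  obtain c where c: "f = (\<lambda>g. \<Sum>Y\<in>char_partition G S. c Y * sigma_char G Y g)"
    using theory_as_supercharacter_sum[OF f] .
  have coeff: "char_coeff f \<xi> = c X" if "\<xi> \<in> X" for \<xi>
  proof -
    have "char_coeff f \<xi> = (\<Sum>Y\<in>char_partition G S. c Y * (if \<xi> \<in> Y then 1 else 0))"
      unfolding c using that sub char_coeff_sigma_char[OF char_partition_subset, of _ \<xi>]
      by (auto simp: char_coeff_sum intro!: sum.cong)
    also have "\<dots> = (\<Sum>Y\<in>char_partition G S. if Y = X then c X else 0)"
      using that X partition_onD2[OF char_partition_partition]
      by (intro sum.cong) (auto simp: disjoint_def)
    finally show ?thesis using X finite_char_partition by simp
  qed
  note fc = theory_class_function[OF f]
  have "convolution G f (sigma_char G X) g = c X * sigma_char G X g" for g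
  proof -
    have "convolution G f (sigma_char G X) g = convolution G (sigma_char G X) f g"
      using convolution_commute[OF theory_class_function[OF supercharacter_in_theory[OF X]], of f] by simp
    also have "\<dots> = (\<Sum>\<xi>\<in>X. \<xi> \<one> * convolution G \<xi> f g)"
      unfolding sigma_char_def by (rule convolution_sum_left)
    also have "\<dots> = (\<Sum>\<xi>\<in>X. c X * (\<xi> \<one> * \<xi> g))"
      using convolution_commute[OF fc] convolution_Irr[OF fc] coeff sub by (intro sum.cong) auto
    finally show ?thesis unfolding sigma_char_def sum_distrib_left .
  qed
  then show ?thesis using that by blast
qed

end

section \<open>Averaging over a supernormal subgroup\<close>

locale supernormal_subgroup = supercharacter_group +
  fixes N :: "'a set"
  assumes supernormal: "supernormal G S N"
begin

lemma subgroup_N: "subgroup N G"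
  using supernormal unfolding supernormal_def by blast

lemma N_carrier: "n \<in> N \<Longrightarrow> n \<in> carrier G"
  using subgroup.mem_carrier[OF subgroup_N] .

lemma N_mult: "n \<in> N \<Longrightarrow> m \<in> N \<Longrightarrow> n \<otimes> m \<in> N"
  and N_inv: "n \<in> N \<Longrightarrow> inv n \<in> N"
  using subgroup.m_closed[OF subgroup_N] subgroup.m_inv_closed[OF subgroup_N] by blast+

lemma finite_N: "finite N"
  using finite_subset[OF subgroup.subset[OF subgroup_N] finite_carrier] .

lemma card_N_neq_0: "card N \<noteq> 0"
  using finite_N subgroup.one_closed[OF subgroup_N] by auto

lemma superclass_in_N:
  assumes K: "K \<in> superclasses G S" "g \<in> K" "g \<in> N"
  shows "K \<subseteq> N"
proof -
  obtain C where C: "C \<subseteq> superclasses G S" "N = \<Union>C" using supernormal unfolding supernormal_def by blast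
  then obtain L where "L \<in> C" "g \<in> L" using K(3) by blast
  then show ?thesis using superclasses_disjoint[OF K(1) _ K(2), of L] C by blast
qed

lemma mult_in_N_iff:
  assumes n: "n \<in> N" and g: "g \<in> carrier G"
  shows "n \<otimes> g \<in> N \<longleftrightarrow> g \<in> N"
proof
  assume "n \<otimes> g \<in> N"
  then have "inv n \<otimes> (n \<otimes> g) \<in> N" by (rule N_mult[OF N_inv[OF n]])
  then show "g \<in> N" using g N_carrier[OF n] by (simp add: m_assoc[symmetric])
qed (rule N_mult[OF n])

text \<open>The unit for convolution of the functions that are constant on cosets of \<open>N\<close>. Convolution
  with it is averaging over cosets.\<close>
definition N_unit :: "'a \<Rightarrow> complex" where
  "N_unit g = (if g \<in> N then of_nat (card (carrier G)) / of_nat (card N) else 0)"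

lemma N_unit_in_theory: "N_unit \<in> S"
proof (rule constant_on_superclasses_in_theory)
  fix g assume "g \<notin> carrier G"
  then show "N_unit g = 0" using N_carrier unfolding N_unit_def by auto
next
  fix K g h assume "K \<in> superclasses G S" "g \<in> K" "h \<in> K"
  then have "g \<in> N \<longleftrightarrow> h \<in> N" using superclass_in_N by blast
  then show "N_unit g = N_unit h" unfolding N_unit_def by simp
qed

lemma convolution_N_unit:
  assumes f: "f \<in> class_functions G" and g: "g \<in> carrier G"
  shows "convolution G N_unit f g = (\<Sum>n\<in>N. f (n \<otimes> g)) / of_nat (card N)"
proof -
  let ?c = "of_nat (card (carrier G)) / of_nat (card N) :: complex"
  have "(\<Sum>y\<in>carrier G. N_unit y * f (g \<otimes> inv y)) = (\<Sum>y\<in>N. ?c * f (g \<otimes> inv y))"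
    using N_carrier by (intro sum.mono_neutral_cong_right) (auto simp: N_unit_def)
  also have "\<dots> = (\<Sum>y\<in>N. ?c * f (inv y \<otimes> g))"
    using N_carrier by (intro sum.cong refl) (subst class_function_swap[OF f g], auto)
  also have "\<dots> = (\<Sum>n\<in>N. ?c * f (n \<otimes> g))"
    by (rule sum.reindex_bij_witness[of _ "\<lambda>x. inv x" "\<lambda>x. inv x"]) (auto simp: N_carrier N_inv)
  also have "\<dots> = ?c * (\<Sum>n\<in>N. f (n \<otimes> g))" by (simp only: sum_distrib_left)
  finally show ?thesis using card_carrier_neq_0 by (simp add: convolution_at[OF g])
qed

lemma coset_average_invariant:
  assumes m: "m \<in> N" and g: "g \<in> carrier G"
  shows "(\<Sum>n\<in>N. f (n \<otimes> (m \<otimes> g))) = (\<Sum>n\<in>N. f (n \<otimes> g))"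
  by (rule sum.reindex_bij_witness[of _ "\<lambda>n. n \<otimes> inv m" "\<lambda>n. n \<otimes> m"])
    (use m g in \<open>auto simp: m_assoc N_carrier N_mult N_inv\<close>)

text \<open>Averaging over cosets of \<open>N\<close> multiplies \<open>\<chi>\<close> by a scalar \<open>c\<close>. If \<open>c\<close> is nonzero, \<open>\<chi>\<close> inherits
  coset invariance from its average. If \<open>c\<close> is zero, all coset sums vanish, while the sum over \<open>N\<close> would be
  \<open>|N|\<close> times the degree if \<open>N\<close> were contained in the kernel.\<close>
lemma supercharacter_dichotomy:
  assumes \<chi>: "\<chi> \<in> supercharacters G S"
  shows "if N \<subseteq> char_ker G \<chi> then \<forall>g\<in>carrier G. \<forall>n\<in>N. \<chi> (n \<otimes> g) = \<chi> g
    else \<forall>g\<in>carrier G. (\<Sum>n\<in>N. \<chi> (n \<otimes> g)) = 0"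
proof -
  obtain X where X: "X \<in> char_partition G S" "\<chi> = sigma_char G X"
    using \<chi> unfolding supercharacters_def by blast
  note \<chi>c = theory_class_function[OF supercharacter_in_theory[OF X(1)], folded X(2)]
  obtain c where c: "\<And>g. convolution G N_unit \<chi> g = c * \<chi> g"
    using theory_acts_on_supercharacter[OF N_unit_in_theory X(1)] X(2) by auto
  have avg: "(\<Sum>n\<in>N. \<chi> (n \<otimes> g)) = of_nat (card N) * (c * \<chi> g)" if "g \<in> carrier G" for g
    using c[of g] convolution_N_unit[OF \<chi>c that] card_N_neq_0 by (simp add: field_simps)
  show ?thesis
  proof (cases "c = 0")
    case True
    have "\<not> N \<subseteq> char_ker G \<chi>"
    proof
      assume ker: "N \<subseteq> char_ker G \<chi>"
      have "(\<Sum>n\<in>N. \<chi> (n \<otimes> \<one>)) = (\<Sum>n\<in>N. \<chi> \<one>)"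
        using ker N_carrier unfolding char_ker_def by (intro sum.cong) auto
      then show False
        using avg[OF one_closed] True card_N_neq_0 supercharacter_degree_neq_0[OF X(1)] X(2) by simp
    qed
    then show ?thesis using avg True by simp
  next
    case False
    have inv: "\<chi> (n \<otimes> g) = \<chi> g" if "n \<in> N" "g \<in> carrier G" for n g
      using coset_average_invariant[OF that, of \<chi>] avg[of g] avg[of "n \<otimes> g"] that N_carrier False card_N_neq_0
      by auto
    have "N \<subseteq> char_ker G \<chi>"
      using inv[of _ \<one>] N_carrier unfolding char_ker_def by auto
    then show ?thesis using inv by simp
  qed
qed

text \<open>Suppose every supercharacter whose kernel does not contain \<open>N\<close> vanishes at \<open>g\<close>. Then at \<open>g\<close> each supercharacter
  equals its average over the coset of \<open>g\<close>, and so does the regular character. But its sum over the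
  coset \<open>N\<close> is \<open>|G|\<close>, whereas \<open>|N|\<close> times its value at \<open>g\<close> is \<open>0\<close> for \<open>g \<noteq> \<one>\<close> and \<open>|N| |G|\<close> for \<open>g = \<one>\<close>.\<close>
lemma supercharacter_nonzero_on_N:
  assumes nontriv: "N \<noteq> {\<one>}" and g: "g \<in> N"
  shows "\<exists>\<chi>\<in>supercharacters G S. \<not> N \<subseteq> char_ker G \<chi> \<and> \<chi> g \<noteq> 0"
proof (rule ccontr)
  assume none: "\<not> ?thesis"
  let ?P = "char_partition G S" and ?\<delta> = "\<lambda>g. if g = \<one> then of_nat (card (carrier G)) else 0 :: complex"
  have gc: "g \<in> carrier G" using N_carrier[OF g] .
  have avg: "(\<Sum>n\<in>N. sigma_char G X (n \<otimes> g)) = of_nat (card N) * sigma_char G X g" if X: "X \<in> ?P" for X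
  proof -
    have \<chi>: "sigma_char G X \<in> supercharacters G S" using X unfolding supercharacters_def by blast
    show ?thesis
      using supercharacter_dichotomy[OF \<chi>] none \<chi> gc by (cases "N \<subseteq> char_ker G (sigma_char G X)") auto
  qed
  have "(\<Sum>n\<in>N. ?\<delta> (n \<otimes> g)) = (\<Sum>n\<in>N. \<Sum>X\<in>?P. sigma_char G X (n \<otimes> g))"
    by (simp only: sum_supercharacters)
  also have "\<dots> = (\<Sum>X\<in>?P. of_nat (card N) * sigma_char G X g)"
    by (subst sum.swap) (simp add: avg)
  also have "\<dots> = of_nat (card N) * ?\<delta> g"
    by (simp only: sum_distrib_left[symmetric] sum_supercharacters)
  also have "(\<Sum>n\<in>N. ?\<delta> (n \<otimes> g)) = (\<Sum>n\<in>N. if n = inv g then of_nat (card (carrier G)) else 0)"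
  proof (rule sum.cong[OF refl])
    fix n assume "n \<in> N"
    then have "n \<otimes> g = \<one> \<longleftrightarrow> n = inv g" using gc N_carrier by (metis inv_equality l_inv)
    then show "?\<delta> (n \<otimes> g) = (if n = inv g then of_nat (card (carrier G)) else 0)" by simp
  qed
  also have "\<dots> = of_nat (card (carrier G))"
    using finite_N subgroup.m_inv_closed[OF subgroup_N g] by simp
  finally have eq: "of_nat (card (carrier G)) = of_nat (card N) * ?\<delta> g" .
  then have "g = \<one>" using card_carrier_neq_0 by (auto split: if_splits)
  then have "of_nat (card N) = (1 :: complex)" using eq card_carrier_neq_0 by simp
  then have "card N = 1" using of_nat_eq_1_iff by blast
  then show False using nontriv subgroup.one_closed[OF subgroup_N] by (metis card_1_singletonE singletonD)
qed

text \<open>Outside \<open>N\<close>, a function that is constant on a coset and sums to zero over it is zero there. In the other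
  direction, each supercharacter is either constant on all cosets or zero outside \<open>N\<close>.\<close>
lemma coset_constant_iff_vanishing:
  "(\<forall>f\<in>S. \<forall>g\<in>carrier G - N. \<forall>n\<in>N. f (n \<otimes> g) = f g) \<longleftrightarrow>
   (\<forall>g\<in>carrier G - N. \<forall>\<chi>\<in>supercharacters G S. \<not> N \<subseteq> char_ker G \<chi> \<longrightarrow> \<chi> g = 0)"
proof (intro iffI ballI impI)
  fix g \<chi>
  assume const: "\<forall>f\<in>S. \<forall>g\<in>carrier G - N. \<forall>n\<in>N. f (n \<otimes> g) = f g"
    and g: "g \<in> carrier G - N" and \<chi>: "\<chi> \<in> supercharacters G S" and ker: "\<not> N \<subseteq> char_ker G \<chi>"
  have "\<chi> \<in> S" using \<chi> supercharacter_in_theory unfolding supercharacters_def by blast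
  then have "\<forall>n\<in>N. \<chi> (n \<otimes> g) = \<chi> g" using const g by blast
  then have "(\<Sum>n\<in>N. \<chi> (n \<otimes> g)) = of_nat (card N) * \<chi> g" by simp
  moreover have "(\<Sum>n\<in>N. \<chi> (n \<otimes> g)) = 0" using supercharacter_dichotomy[OF \<chi>] ker g by simp
  ultimately show "\<chi> g = 0" using card_N_neq_0 by simp
next
  fix f g n
  assume van: "\<forall>g\<in>carrier G - N. \<forall>\<chi>\<in>supercharacters G S. \<not> N \<subseteq> char_ker G \<chi> \<longrightarrow> \<chi> g = 0"
    and f: "f \<in> S" and g: "g \<in> carrier G - N" and n: "n \<in> N"
  have ng: "n \<otimes> g \<in> carrier G - N" using mult_in_N_iff[OF n] g N_carrier[OF n] by auto
  obtain c where c: "f = (\<lambda>g. \<Sum>X\<in>char_partition G S. c X * sigma_char G X g)"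
    using theory_as_supercharacter_sum[OF f] .
  have "sigma_char G X (n \<otimes> g) = sigma_char G X g" if X: "X \<in> char_partition G S" for X
  proof -
    have \<chi>: "sigma_char G X \<in> supercharacters G S" using X unfolding supercharacters_def by blast
    show ?thesis
    proof (cases "N \<subseteq> char_ker G (sigma_char G X)")
      case True
      then show ?thesis using supercharacter_dichotomy[OF \<chi>] g n by simp
    next
      case False
      then have "sigma_char G X (n \<otimes> g) = 0" "sigma_char G X g = 0" using van \<chi> g ng by blast+
      then show ?thesis by simp
    qed
  qed
  then show "f (n \<otimes> g) = f g" unfolding c by simp
qed

section \<open>Star products and cosets\<close>

lemma rcoset_eq_iff:
  assumes "g \<in> carrier G" "h \<in> carrier G"
  shows "N #> g = N #> h \<longleftrightarrow> (\<exists>n\<in>N. h = n \<otimes> g)"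
proof
  assume "N #> g = N #> h"
  then have "h \<in> N #> g" using rcos_self[OF assms(2) subgroup_N] by simp
  then show "\<exists>n\<in>N. h = n \<otimes> g" unfolding r_coset_def by blast
next
  assume "\<exists>n\<in>N. h = n \<otimes> g"
  then have "h \<in> N #> g" unfolding r_coset_def by blast
  then show "N #> g = N #> h" using repr_independence[OF _ assms(1) subgroup_N] by simp
qed

lemma rcoset_eq_N_iff:
  assumes "g \<in> carrier G"
  shows "N #> g = N \<longleftrightarrow> g \<in> N"
  using assms coset_join1[OF _ assms subgroup_N] coset_join2[OF assms subgroup_N] by blast

lemma image_of_superclass_avoids_N:
  assumes K: "K \<in> superclasses G S" and g: "g \<in> K" "g \<notin> N" and h: "h \<in> K"
  shows "N #> h \<noteq> N"
  using superclass_in_N[OF K h] g superclassE(1)[OF K h] rcoset_eq_N_iff by blast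

text \<open>The indicator of the trivial coset belongs to the quotient theory because a superclass meeting \<open>N\<close> lies in \<open>N\<close>.\<close>
lemma quotient_superclass_of_N:
  assumes L: "L \<in> superclasses (G Mod N) (theory_quot G S N)" and N: "N \<in> L"
  shows "L = {N}"
proof -
  define u :: "'a set \<Rightarrow> complex" where "u D = (if D = N then 1 else 0)" for D
  have "N = N #> \<one>" using rcoset_eq_N_iff[OF one_closed] subgroup.one_closed[OF subgroup_N] by simp
  then have Nc: "N \<in> rcosets N" unfolding RCOSETS_def by blast
  have "u \<in> theory_quot G S N"
    unfolding theory_quot_def theory_of_classes_def
  proof (intro CollectI conjI allI impI ballI)
    fix D assume "D \<notin> carrier (G Mod N)"
    then show "u D = 0" using Nc unfolding u_def FactGroup_def by auto
  next
    fix B D E assume "B \<in> (\<lambda>K. (\<lambda>g. N #> g) ` K) ` superclasses G S" "D \<in> B" "E \<in> B"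
    then obtain K g h where K: "K \<in> superclasses G S" "g \<in> K" "h \<in> K" "D = N #> g" "E = N #> h" by blast
    then have "g \<in> N \<longleftrightarrow> h \<in> N" using superclass_in_N by blast
    then show "u D = u E" using K rcoset_eq_N_iff superclassE(1)[OF K(1)] unfolding u_def by simp
  qed
  then have "u D = u N" if "D \<in> L" for D using superclassE(2)[OF L N] that by auto
  then have "D = N" if "D \<in> L" for D using that unfolding u_def by (metis zero_neq_one)
  then show ?thesis using N by blast
qed

text \<open>A class of the star product outside \<open>N\<close> is a full preimage under \<open>G \<rightarrow> G/N\<close> and so a union of cosets. Conversely,
  if the members of \<open>S\<close> are constant on cosets outside \<open>N\<close>, then \<open>S\<close> and the star product
  impose the same conditions: inside \<open>N\<close> by restriction to \<open>N\<close>, and outside by descending to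
  functions on \<open>G/N\<close>.\<close>
lemma star_product_iff_coset_constant:
  "is_star_product_over G S N \<longleftrightarrow> (\<forall>f\<in>S. \<forall>g\<in>carrier G - N. \<forall>n\<in>N. f (n \<otimes> g) = f g)"
proof
  assume star: "is_star_product_over G S N"
  show "\<forall>f\<in>S. \<forall>g\<in>carrier G - N. \<forall>n\<in>N. f (n \<otimes> g) = f g"
  proof (intro ballI)
    fix f g n assume f: "f \<in> S" and g: "g \<in> carrier G - N" and n: "n \<in> N"
    have "N #> g \<in> carrier (G Mod N)" using g unfolding FactGroup_def RCOSETS_def by auto
    then obtain L where L: "L \<in> superclasses (G Mod N) (theory_quot G S N)" "N #> g \<in> L"
      by (rule superclass_of)
    have "L \<noteq> {N}" using L(2) rcoset_eq_N_iff g by auto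
    then have "{h \<in> carrier G. N #> h \<in> L} \<in>
        (\<lambda>L. {g \<in> carrier G. N #> g \<in> L}) ` (superclasses (G Mod N) (theory_quot G S N) - {{N}})"
      using L(1) by blast
    moreover have "N #> (n \<otimes> g) = N #> g" using rcoset_eq_iff[of g "n \<otimes> g"] g n N_carrier by auto
    then have "n \<otimes> g \<in> {h \<in> carrier G. N #> h \<in> L}" "g \<in> {h \<in> carrier G. N #> h \<in> L}"
      using L(2) g n N_carrier by auto
    moreover have "f \<in> star_product G N (theory_sub G S N) (theory_quot G S N)"
      using star f unfolding is_star_product_over_def by simp
    ultimately show "f (n \<otimes> g) = f g"
      unfolding star_product_def by (intro theory_of_classesD(2)[OF _ UnI2])
  qed
next
  assume const: "\<forall>f\<in>S. \<forall>g\<in>carrier G - N. \<forall>n\<in>N. f (n \<otimes> g) = f g"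
  have "f \<in> star_product G N (theory_sub G S N) (theory_quot G S N)" if f: "f \<in> S" for f
    unfolding star_product_def theory_of_classes_def
  proof (intro CollectI conjI allI impI ballI, goal_cases)
    case (1 g)
    then show ?case using class_functionsD(1)[OF theory_class_function[OF f]] by simp
  next
    case (2 B g h)
    from 2(1) show ?case
    proof
      assume B: "B \<in> superclasses (G\<lparr>carrier := N\<rparr>) (theory_sub G S N)"
      \<comment> \<open>Members of a theory of \<open>N\<close> vanish outside \<open>N\<close>, so \<open>f\<close> is cut off.\<close>
      define t where "t x = (if x \<in> N then f x else 0)" for x
      have "t \<in> theory_sub G S N"
        unfolding theory_sub_def theory_of_classes_def t_def
        using theory_constant_on_superclass[OF _ f] by auto
      moreover have "g \<in> N" "h \<in> N" using superclassE(1)[OF B] 2 by auto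
      ultimately show ?thesis using superclassE(2)[OF B 2(2)] 2(3) unfolding t_def by auto
    next
      assume "B \<in> (\<lambda>L. {g \<in> carrier G. N #> g \<in> L}) ` (superclasses (G Mod N) (theory_quot G S N) - {{N}})"
      then obtain L where L: "L \<in> superclasses (G Mod N) (theory_quot G S N)" "L \<noteq> {N}"
        and B: "B = {g \<in> carrier G. N #> g \<in> L}" by blast
      have gh: "g \<in> carrier G" "h \<in> carrier G" "N #> g \<in> L" "N #> h \<in> L" using 2 B by auto
      have "N \<notin> L" using quotient_superclass_of_N[OF L(1)] L(2) by blast
      then have ne: "N #> g \<noteq> N" "N #> h \<noteq> N" using gh by auto
      \<comment> \<open>The function on \<open>G/N\<close> induced by \<open>f\<close>. Since \<open>f\<close> need not be constant on \<open>N\<close>, its value there is replaced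
         by \<open>0\<close>; no class other than \<open>{N}\<close> contains the trivial coset.\<close>
      define u where "u D = (if D \<in> rcosets N \<and> D \<noteq> N then f (SOME x. x \<in> D) else 0)" for D
      have u: "u (N #> x) = f x" if x: "x \<in> carrier G" "N #> x \<noteq> N" for x
      proof -
        have "(SOME y. y \<in> N #> x) \<in> N #> x" using rcos_self[OF x(1) subgroup_N] by (rule someI)
        then obtain n where "n \<in> N" "(SOME y. y \<in> N #> x) = n \<otimes> x" unfolding r_coset_def by blast
        moreover have "x \<notin> N" using x rcoset_eq_N_iff by blast
        moreover have "N #> x \<in> rcosets N" using x(1) unfolding RCOSETS_def by blast
        ultimately show ?thesis using const f x unfolding u_def by auto
      qed
      have "u \<in> theory_quot G S N"
        unfolding theory_quot_def theory_of_classes_def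
      proof (intro CollectI conjI allI impI ballI)
        fix D assume "D \<notin> carrier (G Mod N)"
        then show "u D = 0" unfolding u_def FactGroup_def by auto
      next
        fix B D E assume "B \<in> (\<lambda>K. (\<lambda>g. N #> g) ` K) ` superclasses G S" "D \<in> B" "E \<in> B"
        then obtain K x y where K: "K \<in> superclasses G S" "x \<in> K" "y \<in> K" "D = N #> x" "E = N #> y" by blast
        note c = superclassE(1)[OF K(1,2)] superclassE(1)[OF K(1,3)]
        show "u D = u E"
        proof (cases "x \<in> N")
          case True
          then have "y \<in> N" using superclass_in_N[OF K(1,2)] K(3) by blast
          then have "N #> x = N" "N #> y = N" using True c rcoset_eq_N_iff by blast+
          then show ?thesis using K(4,5) by simp
        next
          case False
          note avoid = image_of_superclass_avoids_N[OF K(1,2) False]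
          show ?thesis
            unfolding K(4,5) u[OF c(1) avoid[OF K(2)]] u[OF c(2) avoid[OF K(3)]]
            by (rule theory_constant_on_superclass[OF K(1) f K(2,3)])
        qed
      qed
      then have "u (N #> g) = u (N #> h)" using superclassE(2)[OF L(1) gh(3)] gh(4) by auto
      then show ?thesis using u gh ne by simp
    qed
  qed
  moreover have "f \<in> S" if f: "f \<in> star_product G N (theory_sub G S N) (theory_quot G S N)" for f
  proof (rule constant_on_superclasses_in_theory)
    show "f g = 0" if "g \<notin> carrier G" for g
      using theory_of_classesD(1)[OF f[unfolded star_product_def] that] .
  next
    fix K g h assume K: "K \<in> superclasses G S" "g \<in> K" "h \<in> K"
    note c = superclassE(1)[OF K(1,2)] superclassE(1)[OF K(1,3)]
    have in_class: "f g = f h"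
      if "B \<in> superclasses (G\<lparr>carrier := N\<rparr>) (theory_sub G S N) \<union>
        (\<lambda>L. {g \<in> carrier G. N #> g \<in> L}) ` (superclasses (G Mod N) (theory_quot G S N) - {{N}})"
        "g \<in> B" "h \<in> B" for B
      using theory_of_classesD(2)[OF f[unfolded star_product_def] that] .
    show "f g = f h"
    proof (cases "g \<in> N")
      case True
      then have KN: "K \<subseteq> N" using superclass_in_N[OF K(1,2)] by blast
      have "g \<in> carrier (G\<lparr>carrier := N\<rparr>)" using True by simp
      then obtain B where B: "B \<in> superclasses (G\<lparr>carrier := N\<rparr>) (theory_sub G S N)" "g \<in> B"
        by (rule superclass_of)
      have "t g = t h" if "t \<in> theory_sub G S N" for t
        using theory_of_classesD(2)[OF that[unfolded theory_sub_def] _ K(2,3)] K(1) KN by blast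
      then have "h \<in> B" using superclassE(2)[OF B] K(3) KN by auto
      then show ?thesis using in_class[of B] B by blast
    next
      case False
      have "N #> g \<in> carrier (G Mod N)" using c unfolding FactGroup_def RCOSETS_def by auto
      then obtain L where L: "L \<in> superclasses (G Mod N) (theory_quot G S N)" "N #> g \<in> L"
        by (rule superclass_of)
      have "t (N #> g) = t (N #> h)" if "t \<in> theory_quot G S N" for t
        using theory_of_classesD(2)[OF that[unfolded theory_quot_def] imageI[OF K(1)]] K(2,3) by blast
      moreover have "N #> h \<in> carrier (G Mod N)" using c unfolding FactGroup_def RCOSETS_def by auto
      ultimately have "N #> h \<in> L" using superclassE(2)[OF L] by auto
      moreover have "L \<noteq> {N}" using L(2) rcoset_eq_N_iff[OF c(1)] False by auto
      ultimately show ?thesis using in_class[of "{g \<in> carrier G. N #> g \<in> L}"] L c by blast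
    qed
  qed
  ultimately show "is_star_product_over G S N" unfolding is_star_product_over_def by blast
qed

text \<open>The generated subgroup always contains \<open>N\<close>: for nontrivial \<open>N\<close> every element of \<open>N\<close> is a
  generator, and trivial \<open>N\<close> lies in every subgroup. So equality says that the generators lie in \<open>N\<close>.\<close>
lemma vanishing_off_subgroup_eq_iff:
  "vanishing_off_subgroup G S N = N \<longleftrightarrow>
   (\<forall>g\<in>carrier G - N. \<forall>\<chi>\<in>supercharacters G S. \<not> N \<subseteq> char_ker G \<chi> \<longrightarrow> \<chi> g = 0)"
proof -
  define A where "A = {g \<in> carrier G. \<exists>\<chi>\<in>supercharacters_over G S N. \<chi> g \<noteq> 0}"
  have V: "vanishing_off_subgroup G S N = generate G A" by (simp only: vanishing_off_subgroup_def A_def)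
  have "N \<subseteq> generate G A"
  proof (cases "N = {\<one>}")
    case True
    then show ?thesis using generate.one by auto
  next
    case False
    then have "N \<subseteq> A"
      using supercharacter_nonzero_on_N N_carrier unfolding A_def supercharacters_over_def by blast
    then show ?thesis by (auto intro: generate.incl)
  qed
  moreover have "generate G A \<subseteq> N \<longleftrightarrow> A \<subseteq> N"
  proof
    assume "generate G A \<subseteq> N"
    then show "A \<subseteq> N" by (auto intro: generate.incl)
  qed (rule generate_subgroup_incl[OF _ subgroup_N])
  ultimately have "vanishing_off_subgroup G S N = N \<longleftrightarrow> A \<subseteq> N" unfolding V by blast
  then show ?thesis unfolding A_def supercharacters_over_def by blast
qed

end

(* The last equivalence carries N \<noteq> {\<one>} because for trivial N no supercharacter has a kernel
   failing to contain N, so its left-hand side fails at \<one> while the other conditions hold. *)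
theorem theorem2:
  fixes G :: "('a, 'b) monoid_scheme" and S :: "('a \<Rightarrow> complex) set" and N :: "'a set"
  assumes "group G" and "finite (carrier G)"
    and "supercharacter_theory G S"
    and "supernormal G S N"
  shows "(is_star_product_over G S N \<longleftrightarrow> vanishing_off_subgroup G S N = N) \<and>
    ((\<forall>g\<in>carrier G - N. \<forall>\<chi>\<in>supercharacters G S. \<not> N \<subseteq> char_ker G \<chi> \<longrightarrow> \<chi> g = 0) \<and>
     (\<forall>g\<in>N. \<exists>\<chi>\<in>supercharacters G S. \<not> N \<subseteq> char_ker G \<chi> \<and> \<chi> g \<noteq> 0)
      \<longleftrightarrow> is_star_product_over G S N \<and> N \<noteq> {\<one>\<^bsub>G\<^esub>})"
proof -
  interpret supernormal_subgroup G S N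
    by (intro supernormal_subgroup.intro supernormal_subgroup_axioms.intro supercharacter_group.intro
        supercharacter_group_axioms.intro finite_group.intro finite_group_axioms.intro assms)
  have star: "is_star_product_over G S N \<longleftrightarrow>
      (\<forall>g\<in>carrier G - N. \<forall>\<chi>\<in>supercharacters G S. \<not> N \<subseteq> char_ker G \<chi> \<longrightarrow> \<chi> g = 0)"
    by (rule trans[OF star_product_iff_coset_constant coset_constant_iff_vanishing])
  have nonzero: "(\<forall>g\<in>N. \<exists>\<chi>\<in>supercharacters G S. \<not> N \<subseteq> char_ker G \<chi> \<and> \<chi> g \<noteq> 0) \<longleftrightarrow> N \<noteq> {\<one>\<^bsub>G\<^esub>}"
  proof
    assume ex: "\<forall>g\<in>N. \<exists>\<chi>\<in>supercharacters G S. \<not> N \<subseteq> char_ker G \<chi> \<and> \<chi> g \<noteq> 0"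
    show "N \<noteq> {\<one>\<^bsub>G\<^esub>}"
    proof
      assume triv: "N = {\<one>\<^bsub>G\<^esub>}"
      have "N \<subseteq> char_ker G \<chi>" for \<chi> unfolding triv char_ker_def by simp
      then show False using ex subgroup.one_closed[OF subgroup_N] by blast
    qed
  qed (intro ballI supercharacter_nonzero_on_N)
  show ?thesis
    by (simp only: star nonzero vanishing_off_subgroup_eq_iff)
qed

end
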